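(* Assume that: $b:\overline G\to\mathbb R^d$ is Lipschitz and $\sigma\in\mathbb R^{d\times d}$ is invertible; $G$ is a bounded convex open subset of $\mathbb R^d$ whose boundary $\partial G$ is of class $W^{3,\infty}$, and there is $\phi\in\mathscr C^2_{\mathrm{lip}}(\mathbb R^d)$ with $G=\{\phi>0\}$, $\partial G=\{\phi=0\}$ and $|\nabla\phi(x)|=1$ for all $x\in\partial G$; $f:\overline G\times\mathbb R^{1\times d}\to\mathbb R$ is such that $f(\cdot,z)$ is continuous for every $z$, there is $C>0$ with $|f(x,z)-f(x,z')|\le C|z-z'|$ for all $x\in\overline G$, $z,z'\in\mathbb R^{1\times d}$, and there is $m\in\mathscr C((0,+\infty),\mathbb R)$ with $m(0^+)=0$ such that $|f(x,z)-f(y,z)|\le m\big((1+|z|)|x-y|\big)$ for all $x\neq y\in\overline G$, $z\in\mathbb R^{1\times d}$; and $g\in\mathscr C^1_{\mathrm{lip}}(\overline G)$. Consider the ergodic PDE with unknown $(v,\lambda)$, $v:\overline G\to\mathbb R$, $\lambda\in\mathbb R$: $$\begin{cases}\mathscr L v(x)+f(x,\nabla v(x)\sigma)-\lambda=0,& x\in G,\\ \dfrac{\partial v(x)}{\partial n}+g(x)=0,& x\in\partial G,\end{cases}\qquad \mathscr L v(x)=\tfrac12\mathrm{Tr}\big(\sigma\,{}^t\sigma\,\nabla^2v(x)\big)+\langle b(x),\nabla v(x)\rangle .$$ If $(v^1,\lambda^1)$ and $(v^2,\lambda^2)$ are two continuous viscosity solutions of this problem such that $v^1(a)=v^2(a)$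 for some $a\in\overline G$, then $\lambda^1=\lambda^2$ and $v^1=v^2$ on $\overline G$.
   Context: $\mathscr C^k_{\mathrm{lip}}$ denotes the functions of class $\mathscr C^k$ whose partial derivatives of order $k$ are Lipschitz. In $\nabla v\,\sigma$ the gradient is regarded as a row vector. The normal derivative is $\frac{\partial v}{\partial n}(x)=\langle\nabla\phi(x),\nabla v(x)\rangle$ for $x\in\partial G$ ($\nabla\phi$ is the inward unit normal on $\partial G$). Viscosity solutions of the Neumann problem are understood in the usual (generalized boundary condition) sense, and only continuous viscosity solutions are considered. *)

theory Defs
  imports "HOL-Analysis.Analysis"
begin

definition grad :: "(real^'d \<Rightarrow> real) \<Rightarrow> real^'d \<Rightarrow> real^'d" where
  "grad u x = (\<chi> i. frechet_derivative u (at x) (axis i 1))"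

definition hessian :: "(real^'d \<Rightarrow> real) \<Rightarrow> real^'d \<Rightarrow> real^'d^'d" where
  "hessian u x = (\<chi> i j. frechet_derivative (\<lambda>y. grad u y $ i) (at x) (axis j 1))"

text \<open>
  Both classes use derivatives relative to the set. On the closure of a bounded convex open set
  the existence and continuity of these derivatives up to the boundary is the usual meaning
  of class \<open>C^k\<close> on a closed domain. In the Lipschitz variant only the partial derivatives
  of order exactly \<open>k\<close> are required to be Lipschitz.
\<close>

primrec class_C :: "nat \<Rightarrow> (real^'d) set \<Rightarrow> (real^'d \<Rightarrow> real) \<Rightarrow> bool" where
  "class_C 0 S u \<longleftrightarrow> continuous_on S u"
| "class_C (Suc k) S u \<longleftrightarrow>
     (\<exists>D :: real^'d \<Rightarrow> real^'d.
        (\<forall>x\<in>S. (u has_derivative (\<lambda>h. D x \<bullet> h)) (at x within S)) \<and>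
        (\<forall>i. class_C k S (\<lambda>x. D x $ i)))"

primrec class_C_lip :: "nat \<Rightarrow> (real^'d) set \<Rightarrow> (real^'d \<Rightarrow> real) \<Rightarrow> bool" where
  "class_C_lip 0 S u \<longleftrightarrow> (\<exists>L. L-lipschitz_on S u)"
| "class_C_lip (Suc k) S u \<longleftrightarrow>
     (\<exists>D :: real^'d \<Rightarrow> real^'d.
        (\<forall>x\<in>S. (u has_derivative (\<lambda>h. D x \<bullet> h)) (at x within S)) \<and>
        (\<forall>i. class_C_lip k S (\<lambda>x. D x $ i)))"

definition test_function :: "(real^'d) set \<Rightarrow> (real^'d \<Rightarrow> real) \<Rightarrow> bool" where
  "test_function U \<psi> \<longleftrightarrow>
     (\<forall>k. class_C k UNIV \<psi>) \<and>
     compact (closure {x. \<psi> x \<noteq> 0}) \<and> closure {x. \<psi> x \<noteq> 0} \<subseteq> U"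

definition weak_partial ::
    "(real^'d) set \<Rightarrow> 'd \<Rightarrow> (real^'d \<Rightarrow> real) \<Rightarrow> (real^'d \<Rightarrow> real) \<Rightarrow> bool" where
  "weak_partial U i u w \<longleftrightarrow>
     (\<forall>\<psi>. test_function U \<psi> \<longrightarrow>
        (LINT x:U|lebesgue. u x * grad \<psi> x $ i) = - (LINT x:U|lebesgue. w x * \<psi> x))"

definition L_infinity :: "(real^'d) set \<Rightarrow> (real^'d \<Rightarrow> real) \<Rightarrow> bool" where
  "L_infinity U u \<longleftrightarrow>
     set_borel_measurable lebesgue U u \<and> (\<exists>M. AE x in lebesgue. x \<in> U \<longrightarrow> \<bar>u x\<bar> \<le> M)"

primrec sobolev_inf :: "nat \<Rightarrow> (real^'d) set \<Rightarrow> (real^'d \<Rightarrow> real) \<Rightarrow> bool" where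
  "sobolev_inf 0 U u \<longleftrightarrow> L_infinity U u"
| "sobolev_inf (Suc k) U u \<longleftrightarrow>
     L_infinity U u \<and> (\<forall>i. \<exists>w. weak_partial U i u w \<and> sobolev_inf k U w)"

text \<open>
  Near each boundary point \<open>G\<close> is the strict epigraph, in some direction \<open>e\<close>, of a
  \<open>W^{k,\<infinity>}\<close> function of the remaining \<open>d - 1\<close> orthogonal coordinates. As the dimension is
  a type, a function on the hyperplane orthogonal to \<open>e\<close> is represented by a function on
  the whole space that is constant in the direction \<open>e\<close>; such a function is in \<open>W^{k,\<infinity>}\<close> of
  the whole space iff its restriction is in \<open>W^{k,\<infinity>}\<close> of the hyperplane. It can be taken
  globally defined and bounded because only its values near the boundary point matter.
  Continuity selects the representative of the a.e.-class.
\<close>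

definition boundary_sobolev_inf :: "nat \<Rightarrow> (real^'d) set \<Rightarrow> bool" where
  "boundary_sobolev_inf k G \<longleftrightarrow>
     (\<forall>x0\<in>frontier G. \<exists>r>0. \<exists>e \<gamma>.
        norm e = 1 \<and>
        (\<forall>x t. \<gamma> (x + t *\<^sub>R e) = \<gamma> x) \<and>
        continuous_on UNIV \<gamma> \<and> sobolev_inf k UNIV \<gamma> \<and>
        G \<inter> ball x0 r = {x \<in> ball x0 r. \<gamma> x < x \<bullet> e})"

definition generator ::
    "(real^'d \<Rightarrow> real^'d) \<Rightarrow> real^'d^'d \<Rightarrow> (real^'d \<Rightarrow> real) \<Rightarrow> real^'d \<Rightarrow> real" where
  "generator b \<sigma> v x =
     1/2 * trace (\<sigma> ** transpose \<sigma> ** hessian v x) + b x \<bullet> grad v x"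

definition interior_op ::
    "(real^'d \<Rightarrow> real^'d) \<Rightarrow> real^'d^'d \<Rightarrow> (real^'d \<Rightarrow> real^'d \<Rightarrow> real) \<Rightarrow> real \<Rightarrow>
     (real^'d \<Rightarrow> real) \<Rightarrow> real^'d \<Rightarrow> real" where
  "interior_op b \<sigma> f lam v x = generator b \<sigma> v x + f x (grad v x v* \<sigma>) - lam"

text \<open>\<open>\<phi>\<close> is the defining function of the domain; its gradient is the inward normal.\<close>

definition boundary_op ::
    "(real^'d \<Rightarrow> real) \<Rightarrow> (real^'d \<Rightarrow> real) \<Rightarrow> (real^'d \<Rightarrow> real) \<Rightarrow> real^'d \<Rightarrow> real" where
  "boundary_op \<phi> g v x = grad \<phi> x \<bullet> grad v x + g x"

definition local_max_on :: "(real^'d) set \<Rightarrow> (real^'d \<Rightarrow> real) \<Rightarrow> real^'d \<Rightarrow> bool" where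
  "local_max_on S u x \<longleftrightarrow> x \<in> S \<and> (\<exists>\<epsilon>>0. \<forall>y\<in>S \<inter> ball x \<epsilon>. u y \<le> u x)"

definition local_min_on :: "(real^'d) set \<Rightarrow> (real^'d \<Rightarrow> real) \<Rightarrow> real^'d \<Rightarrow> bool" where
  "local_min_on S u x \<longleftrightarrow> x \<in> S \<and> (\<exists>\<epsilon>>0. \<forall>y\<in>S \<inter> ball x \<epsilon>. u x \<le> u y)"

text \<open>
  Generalized boundary condition: at a boundary point the equation or the boundary inequality
  has to hold. Both operators carry the sign in which they appear in the problem, opposite
  to the convention for degenerate elliptic operators with the outward normal, so
  subsolutions satisfy \<open>\<ge> 0\<close> with a maximum and supersolutions \<open>\<le> 0\<close> with a minimum.
\<close>

definition viscosity_subsolution ::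
    "(real^'d) set \<Rightarrow> (real^'d \<Rightarrow> real) \<Rightarrow> (real^'d \<Rightarrow> real^'d) \<Rightarrow> real^'d^'d \<Rightarrow>
     (real^'d \<Rightarrow> real^'d \<Rightarrow> real) \<Rightarrow> (real^'d \<Rightarrow> real) \<Rightarrow> (real^'d \<Rightarrow> real) \<Rightarrow> real \<Rightarrow> bool" where
  "viscosity_subsolution G \<phi> b \<sigma> f g v lam \<longleftrightarrow>
     (\<forall>\<Phi> x. class_C 2 UNIV \<Phi> \<and> local_max_on (closure G) (\<lambda>y. v y - \<Phi> y) x \<longrightarrow>
        (x \<in> G \<longrightarrow> interior_op b \<sigma> f lam \<Phi> x \<ge> 0) \<and>
        (x \<in> frontier G \<longrightarrow> max (interior_op b \<sigma> f lam \<Phi> x) (boundary_op \<phi> g \<Phi> x) \<ge> 0))"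

definition viscosity_supersolution ::
    "(real^'d) set \<Rightarrow> (real^'d \<Rightarrow> real) \<Rightarrow> (real^'d \<Rightarrow> real^'d) \<Rightarrow> real^'d^'d \<Rightarrow>
     (real^'d \<Rightarrow> real^'d \<Rightarrow> real) \<Rightarrow> (real^'d \<Rightarrow> real) \<Rightarrow> (real^'d \<Rightarrow> real) \<Rightarrow> real \<Rightarrow> bool" where
  "viscosity_supersolution G \<phi> b \<sigma> f g v lam \<longleftrightarrow>
     (\<forall>\<Phi> x. class_C 2 UNIV \<Phi> \<and> local_min_on (closure G) (\<lambda>y. v y - \<Phi> y) x \<longrightarrow>
        (x \<in> G \<longrightarrow> interior_op b \<sigma> f lam \<Phi> x \<le> 0) \<and>
        (x \<in> frontier G \<longrightarrow> min (interior_op b \<sigma> f lam \<Phi> x) (boundary_op \<phi> g \<Phi> x) \<le> 0))"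

definition viscosity_solution ::
    "(real^'d) set \<Rightarrow> (real^'d \<Rightarrow> real) \<Rightarrow> (real^'d \<Rightarrow> real^'d) \<Rightarrow> real^'d^'d \<Rightarrow>
     (real^'d \<Rightarrow> real^'d \<Rightarrow> real) \<Rightarrow> (real^'d \<Rightarrow> real) \<Rightarrow> (real^'d \<Rightarrow> real) \<Rightarrow> real \<Rightarrow> bool" where
  "viscosity_solution G \<phi> b \<sigma> f g v lam \<longleftrightarrow>
     continuous_on (closure G) v \<and>
     viscosity_subsolution G \<phi> b \<sigma> f g v lam \<and> viscosity_supersolution G \<phi> b \<sigma> f g v lam"

end

theory Submission
  imports Defs
begin

text \<open>
  The difference \<open>v1 - v2\<close> of two solutions is a viscosity subsolution of an extremal problem:
  wherever a \<open>C\<^sup>2\<close> function \<open>\<Phi>\<close> touches it from above,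
  \<open>1/2 Tr (\<sigma> \<sigma>\<^sup>T D\<^sup>2\<Phi>) + K |D\<Phi>| \<ge> lam1 - lam2\<close>, or the point lies on the boundary and
  \<open>\<partial>\<Phi>/\<partial>n \<ge> 0\<close> (\<open>difference_subsolution\<close>). If \<open>lam1 \<ge> lam2\<close>, Hopf's barrier argument then
  shows that \<open>v1 - v2\<close> is constant (\<open>strong_maximum_principle\<close>), and the constant function as a
  test function gives \<open>lam1 \<le> lam2\<close> (\<open>ergodic_constant_le\<close>). Exchanging the two solutions yields
  \<open>lam1 = lam2\<close>, and the common value at \<open>a\<close> makes the constant zero.

  The convexity of \<open>G\<close> lets interior and boundary maxima be treated together. A nearest point
  \<open>x0\<close> of the maximum set to an interior point \<open>y\<close> outside it satisfies \<open>\<langle>\<nu> x0, y - x0\<rangle> > 0\<close> when it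
  is on the boundary, which is exactly the sign that the barrier needs.

  The subsolution property of \<open>v1 - v2\<close> comes from doubling the variables. The second-order step is usually
  Ishii's lemma, which rests on Alexandrov's theorem. Since the diffusion matrix is constant and
  invertible, a weaker statement suffices (\<open>theorem_on_sums\<close>). The sup-convolutions \<open>u\<close>, \<open>w\<close> of
  the two functions attain the maximum of \<open>u + w\<close> at the midpoint of the maximising pair; near this
  midpoint all test gradients are close to the penalisation gradient, so the lower order
  terms are almost constant there, and what remains is a comparison principle for
  \<open>1/2 Tr (\<sigma> \<sigma>\<^sup>T D\<^sup>2u) \<ge> c1\<close> and \<open>1/2 Tr (\<sigma> \<sigma>\<^sup>T D\<^sup>2w) \<ge> c2\<close>: if \<open>u + w\<close> has a local maximum,
  then \<open>c1 + c2 \<le> 0\<close> (\<open>linear_comparison\<close>).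

  For the latter a smooth function \<open>U\<close> is needed with
  \<open>U - s/2 Tr (\<sigma> \<sigma>\<^sup>T D\<^sup>2U)\<close> uniformly close to \<open>u\<close>, and with \<open>U\<close> bounded independently of \<open>s\<close>.
  In coordinates that turn the operator into the Laplacian, products of cosines are
  eigenfunctions, their span is dense in the continuous functions on a cell by the
  Stone-Weierstrass theorem, the resolvent acts on them explicitly, and reflection across the faces
  of the cell gives the bound by the maximum principle. Comparing \<open>u\<close> with \<open>U\<close> and \<open>w\<close> with
  \<open>const - U\<close> gives \<open>0 \<le> - s (c1 + c2) + O(s\<^sup>2)\<close>.
\<close>

section \<open>Twice continuously differentiable functions and the second-order operator\<close>

text \<open>
  Derivatives are carried explicitly: test functions are built from others by sums, translations and
  composition, and the equation needs the values of the derivatives. \<open>C2_with_grad\<close>,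
  \<open>C2_with_hessian\<close> and \<open>C2_with_class_C\<close> connect this with the total functions \<open>grad\<close>,
  \<open>hessian\<close> and with the class \<open>class_C\<close>.
\<close>

definition C2_with ::
    "(real^'d \<Rightarrow> real) \<Rightarrow> (real^'d \<Rightarrow> real^'d) \<Rightarrow> (real^'d \<Rightarrow> real^'d^'d) \<Rightarrow> bool" where
  "C2_with u D H \<longleftrightarrow>
     (\<forall>x. (u has_derivative (\<lambda>h. D x \<bullet> h)) (at x)) \<and>
     (\<forall>x. (D has_derivative (\<lambda>h. H x *v h)) (at x)) \<and>
     continuous_on UNIV H"

lemma grad_eqI:
  assumes "(u has_derivative (\<lambda>h. D \<bullet> h)) (at x)"
  shows "grad u x = D"
  unfolding grad_def frechet_derivative_at[OF assms, symmetric]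
  by (simp add: vec_eq_iff inner_axis)

lemma C2_with_grad: "C2_with u D H \<Longrightarrow> grad u = D"
  by (auto simp: C2_with_def intro!: grad_eqI)

lemma has_derivative_vec_nth:
  "(D has_derivative D') F \<Longrightarrow> ((\<lambda>x. D x $ i) has_derivative (\<lambda>h. D' h $ i)) F"
  by (rule bounded_linear.has_derivative[OF bounded_linear_vec_nth])

lemma C2_with_hessian:
  assumes "C2_with u D H" shows "hessian u = H"
proof
  fix x
  have "((\<lambda>y. D y $ i) has_derivative (\<lambda>h. (H x *v h) $ i)) (at x)" for i
    using assms by (intro has_derivative_vec_nth) (auto simp: C2_with_def)
  from frechet_derivative_at[OF this]
  have "frechet_derivative (\<lambda>y. D y $ i) (at x) = (\<lambda>h. (H x *v h) $ i)" for i
    by simp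
  then show "hessian u x = H x"
    by (simp add: hessian_def C2_with_grad[OF assms] vec_eq_iff matrix_vector_mul_component
        inner_axis)
qed

lemma C2_with_class_C:
  assumes "C2_with u D H" shows "class_C 2 UNIV u"
proof -
  have "((\<lambda>y. D y $ i) has_derivative (\<lambda>h. H x $ i \<bullet> h)) (at x)" for i x
    using assms has_derivative_vec_nth[of D "\<lambda>h. H x *v h" "at x" i]
    by (auto simp: C2_with_def matrix_vector_mul_component)
  moreover have "continuous_on UNIV (\<lambda>x. H x $ i $ j)" for i j
    using assms by (intro continuous_intros) (auto simp: C2_with_def)
  ultimately have "class_C (Suc 0) UNIV (\<lambda>x. D x $ i)" for i
    unfolding class_C.simps by (intro exI[of _ "\<lambda>x. H x $ i"]) auto
  then show ?thesis
    using assms unfolding numeral_2_eq_2 class_C.simps(2)[of "Suc 0"] C2_with_def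
    by (intro exI[of _ D]) auto
qed

lemma C2_with_cont:
  assumes "C2_with u D H"
  shows "continuous_on S u" "continuous_on S D" "continuous_on S H"
proof -
  show "continuous_on S u" "continuous_on S D"
    using assms unfolding C2_with_def
    by (blast intro: continuous_at_imp_continuous_on has_derivative_continuous)+
  show "continuous_on S H"
    using assms continuous_on_subset[of UNIV H S] by (simp add: C2_with_def)
qed

lemma C2_with_add:
  assumes "C2_with u D H" "C2_with u' D' H'"
  shows "C2_with (\<lambda>x. u x + u' x) (\<lambda>x. D x + D' x) (\<lambda>x. H x + H' x)"
  using assms unfolding C2_with_def
  by (auto simp: fun_eq_iff inner_add_left matrix_vector_mult_add_rdistrib
      intro!: continuous_intros intro: has_derivative_eq_rhs[OF has_derivative_add])

lemma C2_with_scale: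
  assumes "C2_with u D H"
  shows "C2_with (\<lambda>x. c * u x) (\<lambda>x. c *\<^sub>R D x) (\<lambda>x. c *\<^sub>R H x)"
  using assms unfolding C2_with_def
  by (auto simp: scaleR_matrix_vector_assoc[symmetric] intro!: derivative_eq_intros
      continuous_intros)

lemma C2_with_affine: "C2_with (\<lambda>x. l \<bullet> x + c) (\<lambda>x. l) (\<lambda>x. 0)"
  unfolding C2_with_def by (auto intro!: derivative_eq_intros)

lemma C2_with_translate:
  assumes "C2_with u D H"
  shows "C2_with (\<lambda>x. u (x + c)) (\<lambda>x. D (x + c)) (\<lambda>x. H (x + c))"
proof -
  have t: "((\<lambda>x. x + c) has_derivative (\<lambda>h. h)) (at x)" for x
    by (auto intro!: derivative_eq_intros)
  have "((\<lambda>x. u (x + c)) has_derivative (\<lambda>h. D (x + c) \<bullet> h)) (at x)"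
    and "((\<lambda>x. D (x + c)) has_derivative (\<lambda>h. H (x + c) *v h)) (at x)" for x
    using assms unfolding C2_with_def by (auto intro!: has_derivative_compose[OF t])
  moreover have "continuous_on UNIV (\<lambda>x. H (x + c))"
    by (intro continuous_on_compose2[OF C2_with_cont(3)[OF assms, of UNIV]] continuous_intros) auto
  ultimately show ?thesis
    unfolding C2_with_def by auto
qed

definition outer :: "real^'d \<Rightarrow> real^'d^'d" where
  "outer p = (\<chi> i j. p $ i * p $ j)"

lemma outer_mult: "outer p *v h = (p \<bullet> h) *\<^sub>R p"
  by (simp add: outer_def matrix_vector_mult_def vec_eq_iff inner_vec_def sum_distrib_left
      mult_ac)

text \<open>
  The chain rule with an outer function of one variable is the only composition rule that the
  construction of cosine modes, quartic penalties and exponential barriers requires.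
\<close>

lemma C2_with_compose:
  assumes u: "C2_with u D H"
    and k: "\<And>t. (k has_real_derivative k' t) (at t)"
    and k': "\<And>t. (k' has_real_derivative k'' t) (at t)"
    and k'': "continuous_on UNIV k''"
  shows "C2_with (\<lambda>x. k (u x)) (\<lambda>x. k' (u x) *\<^sub>R D x)
           (\<lambda>x. k'' (u x) *\<^sub>R outer (D x) + k' (u x) *\<^sub>R H x)"
  unfolding C2_with_def
proof (intro conjI allI)
  fix x
  have u1: "(u has_derivative (\<lambda>h. D x \<bullet> h)) (at x)"
    and D1: "(D has_derivative (\<lambda>h. H x *v h)) (at x)" using u by (auto simp: C2_with_def)
  have ku: "((\<lambda>x. k (u x)) has_derivative (\<lambda>h. k' (u x) * (D x \<bullet> h))) (at x)"
    using has_derivative_compose[OF u1, of k "\<lambda>t. k' (u x) * t"] k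
    by (simp add: has_field_derivative_def)
  then show "((\<lambda>x. k (u x)) has_derivative (\<lambda>h. (k' (u x) *\<^sub>R D x) \<bullet> h)) (at x)"
    by simp
  have ku': "((\<lambda>x. k' (u x)) has_derivative (\<lambda>h. k'' (u x) * (D x \<bullet> h))) (at x)"
    using has_derivative_compose[OF u1, of k' "\<lambda>t. k'' (u x) * t"] k'
    by (simp add: has_field_derivative_def)
  show "((\<lambda>x. k' (u x) *\<^sub>R D x) has_derivative
       (\<lambda>h. (k'' (u x) *\<^sub>R outer (D x) + k' (u x) *\<^sub>R H x) *v h)) (at x)"
    by (rule has_derivative_eq_rhs[OF has_derivative_scaleR[OF ku' D1]])
      (simp add: fun_eq_iff matrix_vector_mult_add_rdistrib outer_mult
        flip: scaleR_matrix_vector_assoc)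
next
  have "continuous_on UNIV k'"
    using k' by (intro DERIV_continuous_on)
  then have "continuous_on UNIV (\<lambda>x. k' (u x))"
    by (rule continuous_on_compose2[OF _ C2_with_cont(1)[OF u]]) auto
  moreover have "continuous_on UNIV (\<lambda>x. k'' (u x))"
    by (rule continuous_on_compose2[OF k'' C2_with_cont(1)[OF u]]) auto
  ultimately show "continuous_on UNIV (\<lambda>x. k'' (u x) *\<^sub>R outer (D x) + k' (u x) *\<^sub>R H x)"
    unfolding outer_def
    by (intro continuous_intros C2_with_cont[OF u]) auto
qed

lemma C2_with_square_norm:
  "C2_with (\<lambda>x. (norm (x - c))\<^sup>2) (\<lambda>x. 2 *\<^sub>R (x - c)) (\<lambda>x. 2 *\<^sub>R mat 1)"
  unfolding C2_with_def power2_norm_eq_inner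
  by (auto intro!: derivative_eq_intros simp: fun_eq_iff inner_commute
      simp flip: scaleR_matrix_vector_assoc)

text \<open>
  The second-order part of the generator, as a function of the Hessian.
\<close>

definition ell :: "real^'d^'d \<Rightarrow> real^'d^'d \<Rightarrow> real" where
  "ell \<sigma> H = 1/2 * trace (\<sigma> ** transpose \<sigma> ** H)"

text \<open>
  The operator is half the sum of the second directional derivatives along the columns of \<open>\<sigma>\<close>,
  which makes its sign at a maximum and its action on cosine products visible.
\<close>

lemma ell_eq: "ell \<sigma> H = 1/2 * (\<Sum>k\<in>UNIV. column k \<sigma> \<bullet> (H *v column k \<sigma>))"
proof -
  have "trace (\<sigma> ** transpose \<sigma> ** H) = (\<Sum>i\<in>UNIV. \<Sum>j\<in>UNIV. \<Sum>k\<in>UNIV. \<sigma>$i$k * \<sigma>$j$k * H$j$i)"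
    by (simp add: trace_def matrix_matrix_mult_def transpose_def sum_distrib_right)
  also have "\<dots> = (\<Sum>i\<in>UNIV. \<Sum>k\<in>UNIV. \<Sum>j\<in>UNIV. \<sigma>$i$k * \<sigma>$j$k * H$j$i)"
    by (intro sum.cong refl sum.swap)
  also have "\<dots> = (\<Sum>k\<in>UNIV. \<Sum>i\<in>UNIV. \<Sum>j\<in>UNIV. \<sigma>$i$k * \<sigma>$j$k * H$j$i)"
    by (rule sum.swap)
  also have "\<dots> = (\<Sum>k\<in>UNIV. \<Sum>j\<in>UNIV. \<Sum>i\<in>UNIV. \<sigma>$i$k * \<sigma>$j$k * H$j$i)"
    by (intro sum.cong refl sum.swap)
  also have "\<dots> = (\<Sum>k\<in>UNIV. column k \<sigma> \<bullet> (H *v column k \<sigma>))"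
    by (simp add: inner_vec_def matrix_vector_mult_def column_def sum_distrib_left mult_ac)
  finally show ?thesis by (simp add: ell_def)
qed

lemma ell_add: "ell \<sigma> (H + H') = ell \<sigma> H + ell \<sigma> H'"
  by (simp add: ell_eq matrix_vector_mult_add_rdistrib inner_add_right sum.distrib distrib_left)

lemma ell_scale: "ell \<sigma> (c *\<^sub>R H) = c * ell \<sigma> H"
  by (simp add: ell_eq scaleR_matrix_vector_assoc[symmetric] sum_distrib_left mult_ac)

lemma ell_minus: "ell \<sigma> (- H) = - ell \<sigma> H"
  using ell_scale[of \<sigma> "-1" H] by simp

lemma ell_zero [simp]: "ell \<sigma> 0 = 0"
  using ell_scale[of \<sigma> 0 0] by simp

lemma continuous_on_ell:
  "continuous_on S H \<Longrightarrow> continuous_on S (\<lambda>x. ell \<sigma> (H x))"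
  unfolding ell_eq matrix_vector_mult_def by (intro continuous_intros)

lemma C2_with_line:
  assumes "C2_with u D H"
  shows "((\<lambda>t. u (x + t *\<^sub>R v)) has_real_derivative D (x + t *\<^sub>R v) \<bullet> v) (at t)"
    and "((\<lambda>t. D (x + t *\<^sub>R v) \<bullet> v) has_real_derivative v \<bullet> (H (x + t *\<^sub>R v) *v v)) (at t)"
proof -
  have l: "((\<lambda>t. x + t *\<^sub>R v) has_derivative (\<lambda>h. h *\<^sub>R v)) (at t)"
    by (auto intro!: derivative_eq_intros)
  have "(u has_derivative (\<lambda>h. D (x + t *\<^sub>R v) \<bullet> h)) (at (x + t *\<^sub>R v))"
    and D: "(D has_derivative (\<lambda>h. H (x + t *\<^sub>R v) *v h)) (at (x + t *\<^sub>R v))"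
    using assms by (auto simp: C2_with_def)
  from has_derivative_compose[OF l this(1)]
  show "((\<lambda>t. u (x + t *\<^sub>R v)) has_real_derivative D (x + t *\<^sub>R v) \<bullet> v) (at t)"
    by (simp add: has_field_derivative_def mult_commute_abs)
  from has_derivative_inner_left[OF has_derivative_compose[OF l D], of v]
  show "((\<lambda>t. D (x + t *\<^sub>R v) \<bullet> v) has_real_derivative v \<bullet> (H (x + t *\<^sub>R v) *v v)) (at t)"
    by (simp add: has_field_derivative_def mult_commute_abs matrix_vector_mult_scaleR inner_commute)
qed

lemma second_derivative_test:
  assumes u: "C2_with u D H" and max: "\<And>y. u y \<le> u x"
  shows "ell \<sigma> (H x) \<le> 0"
proof -
  have "v \<bullet> (H x *v v) \<le> 0" for v
  proof (rule ccontr)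
    assume "\<not> v \<bullet> (H x *v v) \<le> 0"
    then have pos: "0 < v \<bullet> (H (x + 0 *\<^sub>R v) *v v)" by simp
    have 0: "D (x + 0 *\<^sub>R v) \<bullet> v = 0"
      by (rule DERIV_local_max[OF C2_with_line(1)[OF u], of 1]) (use max in auto)
    obtain d where d: "d > 0" "\<And>t. 0 < t \<Longrightarrow> t < d \<Longrightarrow> 0 < D (x + t *\<^sub>R v) \<bullet> v"
      using DERIV_pos_inc_right[OF C2_with_line(2)[OF u] pos] 0 by auto
    obtain z where z: "0 < z" "z < d/2" 
       "u (x + (d/2) *\<^sub>R v) - u (x + 0 *\<^sub>R v) = (d/2 - 0) * (D (x + z *\<^sub>R v) \<bullet> v)"
      using MVT2[of 0 "d/2" "\<lambda>t. u (x + t *\<^sub>R v)" "\<lambda>t. D (x + t *\<^sub>R v) \<bullet> v"] d(1)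
        C2_with_line(1)[OF u] by auto
    have "0 < (d/2 - 0) * (D (x + z *\<^sub>R v) \<bullet> v)" using z d by (intro mult_pos_pos) auto
    with z(3) max[of "x + (d/2) *\<^sub>R v"] show False by simp
  qed
  then show ?thesis by (simp add: ell_eq sum_nonpos)
qed

section \<open>Cosine sums and their resolvents\<close>

text \<open>
  By polarisation, \<open>u w = ((u + w)\<^sup>2 - (u - w)\<^sup>2) / 4\<close>, only squares have to be treated.
\<close>

lemma C2_mult:
  assumes "\<exists>D H. C2_with u D H" "\<exists>D H. C2_with w D H"
  shows "\<exists>D H. C2_with (\<lambda>x. u x * w x) D H"
proof -
  have sq: "\<exists>D H. C2_with (\<lambda>x. (v x)\<^sup>2) D H" if "C2_with v D H" for v :: "real^'d \<Rightarrow> real" and D H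
    using C2_with_compose[OF that, of "\<lambda>t. t\<^sup>2" "\<lambda>t. 2 * t" "\<lambda>t. 2"]
    by (fastforce intro!: derivative_eq_intros)
  obtain D H D' H' where C: "C2_with u D H" "C2_with w D' H'" using assms by blast
  obtain D1 H1 D2 H2 where "C2_with (\<lambda>x. (u x + w x)\<^sup>2) D1 H1"
      "C2_with (\<lambda>x. (u x + - 1 * w x)\<^sup>2) D2 H2"
    using sq[OF C2_with_add[OF C]] sq[OF C2_with_add[OF C(1) C2_with_scale[OF C(2), of "-1"]]]
    by blast
  from C2_with_add[OF C2_with_scale[OF this(1), of "1/4"] C2_with_scale[OF this(2), of "-1/4"]]
  have "C2_with (\<lambda>x. 1/4 * (u x + w x)\<^sup>2 + -1/4 * (u x + - 1 * w x)\<^sup>2)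
     (\<lambda>x. (1/4) *\<^sub>R D1 x + (-1/4) *\<^sub>R D2 x) (\<lambda>x. (1/4) *\<^sub>R H1 x + (-1/4) *\<^sub>R H2 x)" .
  moreover have "1/4 * (u x + w x)\<^sup>2 + -1/4 * (u x + - 1 * w x)\<^sup>2 = u x * w x" for x
    by (simp add: power2_eq_square algebra_simps)
  ultimately show ?thesis by auto
qed

lemma C2_prod:
  assumes "finite I" "\<And>i. i \<in> I \<Longrightarrow> \<exists>D H. C2_with (u i) D H"
  shows "\<exists>D H. C2_with (\<lambda>x. \<Prod>i\<in>I. u i x) D H"
  using assms
proof (induction I rule: finite_induct)
  case empty
  show ?case using C2_with_affine[of 0 1] by auto
next
  case (insert i I)
  then show ?case using C2_mult[of "u i" "\<lambda>x. \<Prod>i\<in>I. u i x"] by auto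
qed

text \<open>
  With \<open>\<tau>\<close> the inverse of \<open>\<sigma>\<close>, the columns of \<open>\<sigma>\<close> are the coordinate directions of
  \<open>y = \<tau> (x - z)\<close>. The phase \<open>\<pi>/2\<close> puts \<open>z\<close> at the centre of the cell
  \<open>|y i| \<le> \<pi>/2\<close>, on whose faces the modes are symmetric under reflection.
\<close>

definition cosmode :: "real^'d^'d \<Rightarrow> real^'d \<Rightarrow> ('d \<Rightarrow> int) \<Rightarrow> real^'d \<Rightarrow> real" where
  "cosmode \<tau> z k x = (\<Prod>i\<in>UNIV. cos (of_int (k i) * ((\<tau> *v (x - z)) $ i + pi/2)))"

inductive_set cos_sums :: "real^'d^'d \<Rightarrow> real^'d \<Rightarrow> (real^'d \<Rightarrow> real) set" for \<tau> z where
  mode: "(\<lambda>x. c * cosmode \<tau> z k x) \<in> cos_sums \<tau> z"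
| add: "P \<in> cos_sums \<tau> z \<Longrightarrow> Q \<in> cos_sums \<tau> z \<Longrightarrow> (\<lambda>x. P x + Q x) \<in> cos_sums \<tau> z"

lemma cos_sums_scale: "P \<in> cos_sums \<tau> z \<Longrightarrow> (\<lambda>x. c * P x) \<in> cos_sums \<tau> z"
proof (induction rule: cos_sums.induct)
  case (mode a k)
  show ?case using cos_sums.mode[of "c * a" \<tau> z k] by (simp add: mult.assoc)
next
  case (add P Q)
  then show ?case by (simp add: distrib_left cos_sums.add)
qed

lemma cosmode_zero [simp]: "cosmode \<tau> z (\<lambda>_. 0) x = 1"
  by (simp add: cosmode_def)

lemma cos_sums_const: "(\<lambda>x. c) \<in> cos_sums \<tau> z"
  using cos_sums.mode[of c \<tau> z "\<lambda>_. 0"] by simp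

text \<open>
  The product-to-sum formula is applied in one coordinate after the other; \<open>A\<close> is the set of the
  coordinates in which the two factors have not been merged yet.
\<close>

lemma cosmode_mult:
  "(\<lambda>x. cosmode \<tau> z k x * cosmode \<tau> z l x) \<in> cos_sums \<tau> z"
proof -
  define C where "C k i x = cos (of_int k * ((\<tau> *v (x - z)) $ i + pi/2))" for k :: int and i x
  have cc: "cos a * cos b = 1/2 * (cos (a + b) + cos (a - b))" for a b :: real
    by (simp add: cos_times_cos)
  have CC: "C k i x * C l i x = 1/2 * (C (k + l) i x + C (k - l) i x)" for k l i x
    unfolding C_def of_int_add of_int_diff distrib_right left_diff_distrib by (rule cc)
  have "(\<lambda>x. (\<Prod>i\<in>A. C (k i) i x * C (l i) i x) * (\<Prod>i\<in>-A. C (m i) i x)) \<in> cos_sums \<tau> z"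
    if "finite A" for A m
    using that
  proof (induction A arbitrary: m rule: finite_induct)
    case empty
    show ?case using cos_sums.mode[of 1 \<tau> z m] by (simp add: cosmode_def C_def)
  next
    case (insert j A)
    have compl: "(\<Prod>i\<in>-A. C ((m(j := q)) i) i x) = C q j x * (\<Prod>i\<in>-insert j A. C (m i) i x)" for q x
    proof -
      have A: "-A = insert j (-insert j A)" using insert.hyps by auto
      have "(\<Prod>i\<in>-A. C ((m(j := q)) i) i x) =
          C q j x * (\<Prod>i\<in>-insert j A. C ((m(j := q)) i) i x)"
        by (subst A, subst prod.insert) auto
      also have "(\<Prod>i\<in>-insert j A. C ((m(j := q)) i) i x) = (\<Prod>i\<in>-insert j A. C (m i) i x)"
        by (intro prod.cong) auto
      finally show ?thesis .
    qed
    have "(\<lambda>x. 1/2 * ((\<Prod>i\<in>A. C (k i) i x * C (l i) i x) * (\<Prod>i\<in>-A. C ((m(j := k j + l j)) i) i x))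
        + 1/2 * ((\<Prod>i\<in>A. C (k i) i x * C (l i) i x) * (\<Prod>i\<in>-A. C ((m(j := k j - l j)) i) i x)))
      \<in> cos_sums \<tau> z"
      by (intro cos_sums.add cos_sums_scale insert.IH)
    moreover have "1/2 * (a * (p * r)) + 1/2 * (a * (q * r)) = 1/2 * (p + q) * a * r"
      for a p q r :: real by (simp add: algebra_simps)
    ultimately show ?case
      unfolding compl prod.insert[OF insert.hyps] CC by (simp only:)
  qed
  from this[of UNIV] show ?thesis
    by (simp add: cosmode_def C_def prod.distrib)
qed

lemma cos_sums_mult:
  assumes "P \<in> cos_sums \<tau> z" "Q \<in> cos_sums \<tau> z"
  shows "(\<lambda>x. P x * Q x) \<in> cos_sums \<tau> z"
  using assms(1)
proof (induction rule: cos_sums.induct)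
  case (mode c k)
  show ?case
    using assms(2)
  proof (induction rule: cos_sums.induct)
    case (mode d l)
    show ?case
      using cos_sums_scale[OF cosmode_mult[of \<tau> z k l], of "c * d"] by (simp add: mult_ac)
  next
    case (add P Q)
    from cos_sums.add[OF add.IH] show ?case by (simp add: algebra_simps)
  qed
next
  case (add P Q)
  from cos_sums.add[OF add.IH] show ?case by (simp add: algebra_simps)
qed

lemma cosmode_C2: "\<exists>D H. C2_with (cosmode \<tau> z k) D H"
  unfolding cosmode_def[abs_def]
proof (rule C2_prod)
  fix i
  have *: "of_int (k i) * ((\<tau> *v (x - z)) $ i + pi/2) =
      (of_int (k i) *\<^sub>R row i \<tau>) \<bullet> x + of_int (k i) * (pi/2 - row i \<tau> \<bullet> z)" for x
    by (simp add: matrix_vector_mul_component row_def inner_diff_right algebra_simps)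
  show "\<exists>D H. C2_with (\<lambda>x. cos (of_int (k i) * ((\<tau> *v (x - z)) $ i + pi/2))) D H"
    unfolding *
    by (intro exI, rule C2_with_compose[OF C2_with_affine, of _ "\<lambda>t. - sin t" "\<lambda>t. - cos t"])
      (auto intro!: derivative_eq_intros continuous_intros)
qed simp

text \<open>
  Along column \<open>i\<close> of \<open>\<sigma>\<close> only the \<open>i\<close>-th cosine varies, with frequency \<open>k i\<close>.
\<close>

lemma cosmode_eigenfunction:
  fixes \<tau> \<sigma> :: "real^'d^'d"
  assumes \<tau>: "\<tau> ** \<sigma> = mat 1" and u: "C2_with (cosmode \<tau> z k) D H"
  shows "ell \<sigma> (H x) = - (1/2 * (\<Sum>i\<in>UNIV. (of_int (k i))\<^sup>2)) * cosmode \<tau> z k x"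
proof -
  have "column i \<sigma> \<bullet> (H x *v column i \<sigma>) = - (of_int (k i))\<^sup>2 * cosmode \<tau> z k x" for i
  proof -
    define v a C where "v = column i \<sigma>" and "a = (\<tau> *v (x - z)) $ i + pi/2"
      and "C = (\<Prod>j\<in>UNIV-{i}. cos (of_int (k j) * ((\<tau> *v (x - z)) $ j + pi/2)))"
    have "\<tau> *v v = axis i 1"
      by (simp add: v_def \<tau> matrix_vector_mul_assoc flip: matrix_vector_mult_basis)
    then have \<tau>v: "\<tau> *v (x + t *\<^sub>R v - z) = \<tau> *v (x - z) + t *\<^sub>R axis i 1" for t
      by (simp add: matrix_vector_right_distrib matrix_vector_mult_diff_distrib
          matrix_vector_mult_scaleR)
    have line: "cosmode \<tau> z k (x + t *\<^sub>R v) = C * cos (of_int (k i) * (a + t))" for t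
    proof -
      have "cosmode \<tau> z k (x + t *\<^sub>R v) = cos (of_int (k i) * (a + t)) *
          (\<Prod>j\<in>UNIV-{i}. cos (of_int (k j) * ((\<tau> *v (x + t *\<^sub>R v - z)) $ j + pi/2)))"
        unfolding cosmode_def
        by (subst prod.remove[of _ i]) (auto simp: \<tau>v a_def axis_def add_ac)
      also have "(\<Prod>j\<in>UNIV-{i}. cos (of_int (k j) * ((\<tau> *v (x + t *\<^sub>R v - z)) $ j + pi/2))) = C"
        unfolding C_def by (intro prod.cong) (auto simp: \<tau>v axis_def)
      finally show ?thesis by simp
    qed
    have "D (x + t *\<^sub>R v) \<bullet> v = - C * of_int (k i) * sin (of_int (k i) * (a + t))" for t
      by (rule DERIV_unique[OF C2_with_line(1)[OF u]]) (auto simp: line intro!: derivative_eq_intros)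
    then have "((\<lambda>t. - C * of_int (k i) * sin (of_int (k i) * (a + t))) has_real_derivative
        v \<bullet> (H (x + 0 *\<^sub>R v) *v v)) (at 0)"
      using C2_with_line(2)[OF u, of x v 0] by simp
    then have "v \<bullet> (H (x + 0 *\<^sub>R v) *v v) =
        - C * of_int (k i) * (of_int (k i) * cos (of_int (k i) * (a + 0)))"
      by (rule DERIV_unique) (auto intro!: derivative_eq_intros)
    then show ?thesis using line[of 0] by (simp add: v_def power2_eq_square)
  qed
  then show ?thesis by (simp add: ell_eq sum_negf flip: sum_distrib_right)
qed

text \<open>
  On a mode the operator \<open>L\<close> is multiplication by a number \<open>- q \<le> 0\<close>, so \<open>U - s L U = P\<close> is
  solved by dividing the coefficient by \<open>1 + s q \<ge> 1\<close>.
\<close>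

lemma cos_sums_resolvent:
  fixes \<tau> \<sigma> :: "real^'d^'d"
  assumes \<tau>: "\<tau> ** \<sigma> = mat 1" and s: "s > 0" and P: "P \<in> cos_sums \<tau> z"
  shows "\<exists>U D H. U \<in> cos_sums \<tau> z \<and> C2_with U D H \<and> (\<forall>x. U x - s * ell \<sigma> (H x) = P x)"
  using P
proof (induction rule: cos_sums.induct)
  case (mode c k)
  obtain D H where C2: "C2_with (cosmode \<tau> z k) D H" using cosmode_C2 by blast
  define q where "q = 1/2 * (\<Sum>i\<in>UNIV. (real_of_int (k i))\<^sup>2)"
  have q: "1 + s * q > 0"
    using s by (auto simp: q_def intro!: add_pos_nonneg mult_nonneg_nonneg sum_nonneg)
  define d where "d = c / (1 + s * q)"
  have "d * cosmode \<tau> z k x - s * ell \<sigma> (d *\<^sub>R H x) = c * cosmode \<tau> z k x" for x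
  proof -
    have "d * cosmode \<tau> z k x - s * ell \<sigma> (d *\<^sub>R H x) = (d * (1 + s * q)) * cosmode \<tau> z k x"
      unfolding ell_scale cosmode_eigenfunction[OF \<tau> C2] q_def[symmetric]
      by (simp add: algebra_simps)
    then show ?thesis using q by (simp add: d_def)
  qed
  then show ?case using cos_sums.mode C2_with_scale[OF C2, of d] by blast
next
  case (add P Q)
  then obtain U D H U' D' H' where U: "U \<in> cos_sums \<tau> z" "C2_with U D H"
      "\<forall>x. U x - s * ell \<sigma> (H x) = P x"
    and U': "U' \<in> cos_sums \<tau> z" "C2_with U' D' H'" "\<forall>x. U' x - s * ell \<sigma> (H' x) = Q x" by blast
  have "U x + U' x - s * ell \<sigma> (H x + H' x) = P x + Q x" for x
    unfolding U(3)[rule_format, symmetric] U'(3)[rule_format, symmetric] ell_add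
    by (simp add: algebra_simps)
  then show ?case using cos_sums.add[OF U(1) U'(1)] C2_with_add[OF U(2) U'(2)] by blast
qed

definition cell :: "real^'d^'d \<Rightarrow> real^'d \<Rightarrow> (real^'d) set" where
  "cell \<tau> z = {x. \<forall>i. \<bar>(\<tau> *v (x - z)) $ i\<bar> \<le> pi/2}"

lemma cell_point:
  fixes \<tau> \<sigma> :: "real^'d^'d"
  assumes \<tau>: "\<tau> ** \<sigma> = mat 1"
  shows "\<tau> *v (z + \<sigma> *v y - z) = y"
proof -
  have "\<tau> *v (z + \<sigma> *v y - z) = \<tau> *v (\<sigma> *v y)" by simp
  then show ?thesis by (simp only: matrix_vector_mul_assoc \<tau> matrix_vector_mul_lid)
qed

lemma left_inverse_imp_right_inverse:
  fixes \<tau> :: "real^'d^'d"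
  assumes "\<tau> ** \<sigma> = mat 1"
  shows "\<sigma> *v (\<tau> *v x) = x"
  using assms matrix_left_right_inverse[of \<tau> \<sigma>]
  by (simp only: matrix_vector_mul_assoc matrix_vector_mul_lid)

lemma compact_cell:
  fixes \<tau> :: "real^'d^'d"
  assumes \<tau>: "\<tau> ** \<sigma> = mat 1"
  shows "compact (cell \<tau> z)"
proof -
  have "cell \<tau> z = (\<lambda>y. z + \<sigma> *v y) ` cbox (\<chi> i. -pi/2) (\<chi> i. pi/2)"
  proof (intro set_eqI iffI)
    fix x assume "x \<in> cell \<tau> z"
    then have "\<tau> *v (x - z) \<in> cbox (\<chi> i. -pi/2) (\<chi> i. pi/2)"
      unfolding cell_def mem_box_cart abs_le_iff mem_Collect_eq vec_lambda_beta
      by (metis minus_divide_left minus_le_iff)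
    moreover have "x = z + \<sigma> *v (\<tau> *v (x - z))"
      by (simp add: left_inverse_imp_right_inverse[OF \<tau>])
    ultimately show "x \<in> (\<lambda>y. z + \<sigma> *v y) ` cbox (\<chi> i. -pi/2) (\<chi> i. pi/2)" by blast
  next
    fix x assume "x \<in> (\<lambda>y. z + \<sigma> *v y) ` cbox (\<chi> i. -pi/2) (\<chi> i. pi/2)"
    then obtain y where y: "x = z + \<sigma> *v y" "y \<in> cbox (\<chi> i. -pi/2) (\<chi> i. pi/2)" by blast
    have "\<bar>y $ i\<bar> \<le> pi/2" for i
      using y(2)[unfolded mem_box_cart vec_lambda_beta, rule_format, of i] by linarith
    then show "x \<in> cell \<tau> z"
      unfolding cell_def mem_Collect_eq y(1) cell_point[OF \<tau>] by blast
  qed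
  also have "compact \<dots>"
    by (intro compact_continuous_image continuous_intros compact_cbox matrix_vector_mult_linear_continuous_on)
  finally show ?thesis .
qed

lemma cos_of_int_cong:
  fixes s t :: real
  assumes "cos s = cos t"
  shows "cos (of_int m * s) = cos (of_int m * t)"
proof -
    from assms obtain n where "n \<in> \<int>" and n: "s = t + 2*n*pi \<or> s = - t + 2*n*pi"
      unfolding cos_eq[of s t] by (elim bexE)
    then obtain j where j: "n = of_int j" by (auto elim: Ints_cases)
    have a: "of_int m * (t + 2*n*pi) = of_int m * t + 2 * of_int (m * j) * pi"
      unfolding j of_int_mult by (simp add: ring_distribs)
    have b: "of_int m * (- t + 2*n*pi) = - (of_int m * t) + 2 * of_int (m * j) * pi"
      unfolding j of_int_mult by (simp add: ring_distribs)
    have "of_int m * s = of_int m * t + 2 * of_int (m * j) * pi \<or>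
        of_int m * s = - (of_int m * t) + 2 * of_int (m * j) * pi"
      by (rule disjE[OF n]) (metis a, metis b)
    then show ?thesis
      unfolding cos_eq[of "of_int m * s"] by (intro bexI[of _ "of_int (m * j)"] Ints_of_int)
qed
lemma cosmode_cong:
  assumes "\<And>i. cos ((\<tau> *v (x - z)) $ i + pi/2) = cos ((\<tau> *v (y - z)) $ i + pi/2)"
  shows "cosmode \<tau> z k x = cosmode \<tau> z k y"
  unfolding cosmode_def using assms by (intro prod.cong cos_of_int_cong) auto

text \<open>
  Every point can be reflected into the cell without changing any cosine sum; hence a bound
  on the cell is a bound on the whole space, and a maximum over the cell is global.
\<close>

lemma cos_sums_fold:
  fixes \<tau> \<sigma> :: "real^'d^'d"
  assumes \<tau>: "\<tau> ** \<sigma> = mat 1"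
  obtains y where "y \<in> cell \<tau> z" "\<And>P. P \<in> cos_sums \<tau> z \<Longrightarrow> P y = P x"
proof -
  define w where "w = (\<chi> i. arccos (cos ((\<tau> *v (x - z)) $ i + pi/2)) - pi/2)"
  define y where "y = z + \<sigma> *v w"
  have \<tau>y: "\<tau> *v (y - z) = w" unfolding y_def by (rule cell_point[OF \<tau>])
  have "\<bar>arccos (cos t) - pi/2\<bar> \<le> pi/2" for t :: real
  proof -
    have "0 \<le> arccos (cos t)" "arccos (cos t) \<le> pi"
      by (auto intro: arccos_lbound arccos_ubound)
    then show ?thesis by linarith
  qed
  then have "y \<in> cell \<tau> z"
    unfolding cell_def mem_Collect_eq \<tau>y w_def vec_lambda_beta by blast
  moreover have "P y = P x" if "P \<in> cos_sums \<tau> z" for P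
    using that
  proof (induction rule: cos_sums.induct)
    case (mode c k)
    have "cosmode \<tau> z k y = cosmode \<tau> z k x"
      by (rule cosmode_cong) (simp add: \<tau>y w_def cos_arccos)
    then show ?case by simp
  qed auto
  ultimately show ?thesis by (rule that)
qed

text \<open>
  Stone-Weierstrass. Points of the cell are separated because the cosine is injective on
  \<open>[0, \<pi>]\<close>.
\<close>

lemma cos_sums_dense:
  fixes \<tau> \<sigma> :: "real^'d^'d"
  assumes \<tau>: "\<tau> ** \<sigma> = mat 1" and u: "continuous_on (cell \<tau> z) u" and e: "e > 0"
  obtains P where "P \<in> cos_sums \<tau> z" "\<And>x. x \<in> cell \<tau> z \<Longrightarrow> \<bar>u x - P x\<bar> < e"
proof -
  have cont: "continuous_on S P" if "P \<in> cos_sums \<tau> z" for P S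
    using that
  proof (induction rule: cos_sums.induct)
    case (mode c k)
    obtain D H where "C2_with (cosmode \<tau> z k) D H" using cosmode_C2 by blast
    from C2_with_cont(1)[OF this] show ?case by (intro continuous_on_mult_left)
  qed (auto intro: continuous_intros)
  interpret function_ring_on "cos_sums \<tau> z" "cell \<tau> z"
  proof
    fix x y assume xy: "x \<in> cell \<tau> z" "y \<in> cell \<tau> z" "x \<noteq> y"
    have "\<tau> *v (x - z) \<noteq> \<tau> *v (y - z)"
      using xy(3) left_inverse_imp_right_inverse[OF \<tau>] by (metis diff_add_cancel)
    then obtain i where i: "(\<tau> *v (x - z)) $ i \<noteq> (\<tau> *v (y - z)) $ i" by (auto simp: vec_eq_iff)
    have single: "cosmode \<tau> z (\<lambda>j. if j = i then 1 else 0) x = cos ((\<tau> *v (x - z)) $ i + pi/2)" for x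
      unfolding cosmode_def by (subst prod.remove[of _ i]) auto
    have "\<bar>(\<tau> *v (x - z)) $ i\<bar> \<le> pi/2" "\<bar>(\<tau> *v (y - z)) $ i\<bar> \<le> pi/2" using xy by (auto simp: cell_def)
    then have "cos ((\<tau> *v (x - z)) $ i + pi/2) \<noteq> cos ((\<tau> *v (y - z)) $ i + pi/2)"
      using i cos_inj_pi[of "(\<tau> *v (x - z)) $ i + pi/2" "(\<tau> *v (y - z)) $ i + pi/2"] by fastforce
    then show "\<exists>f\<in>cos_sums \<tau> z. f x \<noteq> f y"
      using cos_sums.mode[of 1 \<tau> z "\<lambda>j. if j = i then 1 else 0"]
      by (intro bexI[of _ "\<lambda>x. 1 * cosmode \<tau> z (\<lambda>j. if j = i then 1 else 0) x"])
        (auto simp: single)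
  qed (auto intro: compact_cell[OF \<tau>] cont cos_sums.add cos_sums_mult cos_sums_const)
  from Stone_Weierstrass_basic[OF u e] that show ?thesis by blast
qed

text \<open>
  At a global maximum of \<open>U\<close> the second-order term is nonpositive, so \<open>U \<le> P\<close> there. The bound
  does not depend on \<open>s\<close>, which is what the comparison argument needs.
\<close>

lemma cos_sums_resolvent_upper:
  fixes \<tau> \<sigma> :: "real^'d^'d"
  assumes \<tau>: "\<tau> ** \<sigma> = mat 1" and s: "s > 0"
    and U: "U \<in> cos_sums \<tau> z" "C2_with U D H" "\<And>x. U x - s * ell \<sigma> (H x) = P x"
    and P: "\<And>x. x \<in> cell \<tau> z \<Longrightarrow> P x \<le> B"
  shows "U x \<le> B"
proof -
  have "cell \<tau> z \<noteq> {}" using cos_sums_fold[OF \<tau>] by (metis empty_iff)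
  then obtain m where m: "m \<in> cell \<tau> z" "\<And>y. y \<in> cell \<tau> z \<Longrightarrow> U y \<le> U m"
    using continuous_attains_sup[OF compact_cell[OF \<tau>, of z] _ C2_with_cont(1)[OF U(2)]] by blast
  have max: "U y \<le> U m" for y
    using cos_sums_fold[OF \<tau>, of z y] m(2) U(1) by metis
  have "U x \<le> U m" by (rule max)
  also have "U m = P m + s * ell \<sigma> (H m)" using U(3)[of m] by simp
  also have "\<dots> \<le> P m" using second_derivative_test[OF U(2) max] s by (simp add: mult_nonneg_nonpos)
  also have "\<dots> \<le> B" by (rule P[OF m(1)])
  finally show ?thesis .
qed

lemma cos_sums_resolvent_bound:
  fixes \<tau> \<sigma> :: "real^'d^'d"
  assumes \<tau>: "\<tau> ** \<sigma> = mat 1" and s: "s > 0"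
    and U: "U \<in> cos_sums \<tau> z" "C2_with U D H" "\<And>x. U x - s * ell \<sigma> (H x) = P x"
    and P: "\<And>x. x \<in> cell \<tau> z \<Longrightarrow> \<bar>P x\<bar> \<le> B"
  shows "\<bar>U x\<bar> \<le> B"
proof -
  have "U x \<le> B"
    by (rule cos_sums_resolvent_upper[OF \<tau> s U]) (use P in \<open>auto simp: abs_le_iff\<close>)
  moreover have "-1 * U x \<le> B"
    by (rule cos_sums_resolvent_upper[OF \<tau> s cos_sums_scale[OF U(1)] C2_with_scale[OF U(2)],
          where P = "\<lambda>x. - P x"])
      (use P in \<open>auto simp: ell_minus U(3)[symmetric] abs_le_iff\<close>)
  ultimately show ?thesis by (simp add: abs_le_iff)
qed

section \<open>Comparison for the operator with constant right-hand sides\<close>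

definition touches_above :: "(real^'d) set \<Rightarrow> (real^'d \<Rightarrow> real) \<Rightarrow> (real^'d \<Rightarrow> real) \<Rightarrow> real^'d \<Rightarrow> bool" where
  "touches_above S \<Psi> u x \<longleftrightarrow> x \<in> S \<and> (\<exists>e>0. \<forall>y\<in>S \<inter> ball x e. u y - \<Psi> y \<le> u x - \<Psi> x)"

lemma ell_outer: "ell \<sigma> (outer p) = 1/2 * (\<Sum>k\<in>UNIV. (p \<bullet> column k \<sigma>)\<^sup>2)"
  by (simp add: ell_eq outer_mult power2_eq_square inner_commute)

lemma ell_mat_1: "ell \<sigma> (mat 1) = 1/2 * (\<Sum>k\<in>UNIV. (norm (column k \<sigma>))\<^sup>2)"
  by (simp add: ell_eq power2_norm_eq_inner)

lemma ell_outer_le: "ell \<sigma> (outer p) \<le> (norm p)\<^sup>2 * ell \<sigma> (mat 1)"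
proof -
  have "(p \<bullet> column k \<sigma>)\<^sup>2 \<le> (norm p)\<^sup>2 * (norm (column k \<sigma>))\<^sup>2" for k
    using Cauchy_Schwarz_ineq[of p "column k \<sigma>"] by (simp add: power2_norm_eq_inner)
  then show ?thesis
    unfolding ell_outer ell_mat_1 by (simp add: sum_distrib_left sum_mono sum_divide_distrib divide_right_mono)
qed

lemma ell_mat_1_nonneg: "0 \<le> ell \<sigma> (mat 1)"
  unfolding ell_mat_1 by (simp add: sum_nonneg)

text \<open>
  Write \<open>L\<close> for the operator. At an interior maximum of \<open>u - U - \<psi>\<close> with the penalty \<open>\<psi> = A |x - z|\<^sup>4\<close>, the subsolution property
  gives \<open>c \<le> L U + L \<psi>\<close>, and \<open>s L U \<le> U - u + \<eta>\<close>. Since \<open>L \<psi> = O(|x - z|\<^sup>2)\<close>, the error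
  \<open>s L \<psi> - \<psi>\<close> is \<open>O(s\<^sup>2)\<close>: this is why the penalty is quartic, a quadratic one would give an
  error of order \<open>s\<close>. The factor \<open>A\<close> is so large that a maximum on the sphere is harmless.
\<close>

lemma subsolution_below_resolvent:
  fixes u :: "real^'d \<Rightarrow> real"
  assumes \<rho>: "\<rho> > 0" and u: "continuous_on (cball z \<rho>) u"
    and sub: "\<And>\<Psi> D H x. C2_with \<Psi> D H \<Longrightarrow> x \<in> ball z \<rho> \<Longrightarrow> touches_above UNIV \<Psi> u x \<Longrightarrow>
        c \<le> ell \<sigma> (H x)"
    and U: "C2_with U DU HU" and s: "0 < s" "s \<le> 1"
    and res: "\<And>x. x \<in> cball z \<rho> \<Longrightarrow> u x - \<eta> \<le> U x - s * ell \<sigma> (HU x)"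
    and uB: "\<And>x. x \<in> cball z \<rho> \<Longrightarrow> \<bar>u x\<bar> \<le> B"
    and UB: "\<And>x. x \<in> cball z \<rho> \<Longrightarrow> \<bar>U x\<bar> \<le> B"
    and \<eta>: "0 \<le> \<eta>"
  defines "A \<equiv> (2 * B + \<bar>c\<bar>) / \<rho> ^ 4"
  shows "u z - U z \<le> \<eta> - s * c + 36 * A * (ell \<sigma> (mat 1))\<^sup>2 * s\<^sup>2"
proof -
  define T where "T = ell \<sigma> (mat 1)"
  have T: "0 \<le> T" unfolding T_def by (rule ell_mat_1_nonneg)
  have "0 \<le> B" using uB[of z] \<rho> by (auto intro: order_trans[OF abs_ge_zero])
  then have A: "0 \<le> A" using \<rho> by (simp add: A_def)
  define \<psi> H\<psi> where "\<psi> x = A * ((norm (x - z))\<^sup>2)\<^sup>2"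
    and "H\<psi> x = (2 * A) *\<^sub>R outer (2 *\<^sub>R (x - z)) + (2 * A * (norm (x - z))\<^sup>2) *\<^sub>R (2 *\<^sub>R mat 1)"
    for x :: "real^'d"
  obtain D\<psi> where \<psi>: "C2_with \<psi> D\<psi> H\<psi>"
    using C2_with_compose[OF C2_with_square_norm[of z], of "\<lambda>t. A * t\<^sup>2" "\<lambda>t. 2 * A * t" "\<lambda>t. 2 * A"]
    unfolding \<psi>_def[abs_def] H\<psi>_def[abs_def] by (fastforce intro!: derivative_eq_intros)
  have ell\<psi>: "ell \<sigma> (H\<psi> x) \<le> 12 * A * T * (norm (x - z))\<^sup>2" for x
  proof -
    have "ell \<sigma> (H\<psi> x) = 2 * A * ell \<sigma> (outer (2 *\<^sub>R (x - z))) + 4 * A * T * (norm (x - z))\<^sup>2"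
      unfolding H\<psi>_def ell_add ell_scale T_def by simp
    also have "\<dots> \<le> 2 * A * ((norm (2 *\<^sub>R (x - z)))\<^sup>2 * T) + 4 * A * T * (norm (x - z))\<^sup>2"
      unfolding T_def using A by (intro add_right_mono mult_left_mono ell_outer_le) auto
    also have "\<dots> = 12 * A * T * (norm (x - z))\<^sup>2"
      by (simp only: norm_scaleR power_mult_distrib) simp
    finally show ?thesis .
  qed
  have C: "C2_with (\<lambda>x. U x + \<psi> x) (\<lambda>x. DU x + D\<psi> x) (\<lambda>x. HU x + H\<psi> x)"
    by (rule C2_with_add[OF U \<psi>])
  obtain m where m: "m \<in> cball z \<rho>"
    "\<And>y. y \<in> cball z \<rho> \<Longrightarrow> u y - (U y + \<psi> y) \<le> u m - (U m + \<psi> m)"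
    using continuous_attains_sup[of "cball z \<rho>" "\<lambda>x. u x - (U x + \<psi> x)"]
      continuous_on_diff[OF u C2_with_cont(1)[OF C]] \<rho> by auto
  have z: "u z - U z \<le> u m - U m - \<psi> m"
    using m(2)[of z] \<rho> by (simp add: \<psi>_def)
  have "0 \<le> 36 * A * T\<^sup>2 * s\<^sup>2" using A by simp
  show ?thesis
  proof (cases "dist z m < \<rho>")
    case True
    have "touches_above UNIV (\<lambda>x. U x + \<psi> x) u m"
      unfolding touches_above_def
    proof (intro conjI exI[of _ "\<rho> - dist z m"] ballI)
      fix y assume "y \<in> UNIV \<inter> ball m (\<rho> - dist z m)"
      then have "y \<in> cball z \<rho>" using dist_triangle[of z y m] by simp
      then show "u y - (U y + \<psi> y) \<le> u m - (U m + \<psi> m)" by (rule m(2))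
    qed (use True in auto)
    from sub[OF C _ this] True have "c \<le> ell \<sigma> (HU m) + ell \<sigma> (H\<psi> m)" by (simp add: ell_add)
    then have "s * c \<le> s * ell \<sigma> (HU m) + s * ell \<sigma> (H\<psi> m)"
      using s by (simp flip: distrib_left)
    moreover have "s * ell \<sigma> (H\<psi> m) \<le> s * (12 * A * T * (norm (m - z))\<^sup>2)"
      using s by (intro mult_left_mono ell\<psi>) auto
    moreover have "s * (12 * A * T * (norm (m - z))\<^sup>2) - \<psi> m \<le> 36 * A * T\<^sup>2 * s\<^sup>2"
    proof -
      have "0 \<le> A * ((norm (m - z))\<^sup>2 - 6 * T * s)\<^sup>2" using A by simp
      then show ?thesis by (simp add: \<psi>_def power2_eq_square algebra_simps)
    qed
    moreover have "u m - \<eta> \<le> U m - s * ell \<sigma> (HU m)" by (rule res[OF m(1)])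
    ultimately show ?thesis using z unfolding T_def[symmetric] by linarith
  next
    case False
    then have "norm (m - z) = \<rho>" using m(1) by (simp add: dist_norm norm_minus_commute)
    then have "\<psi> m = 2 * B + \<bar>c\<bar>"
      using \<rho> by (simp add: \<psi>_def A_def power_mult[symmetric] field_simps)
    moreover have "s * c \<le> \<bar>c\<bar>"
      using s by (intro order_trans[OF mult_left_mono[OF abs_ge_self] mult_left_le_one_le]) auto
    ultimately show ?thesis
      using z uB[OF m(1)] UB[OF m(1)] \<eta> \<open>0 \<le> 36 * A * T\<^sup>2 * s\<^sup>2\<close> unfolding T_def[symmetric] by linarith
  qed
qed

text \<open>
  The same resolvent \<open>U\<close> of a cosine sum serves both functions: \<open>U - s L U\<close> is close to \<open>u\<close>, hence,
  with \<open>M = u z + w z\<close>, \<open>(M - U) - s L (M - U)\<close> is close to \<open>M - u \<ge> w\<close>. Adding the two estimates at \<open>z\<close>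
  cancels all values and leaves an upper bound \<open>O(s\<^sup>2)\<close> for \<open>s (c1 + c2)\<close>.
\<close>

lemma linear_comparison:
  fixes u w :: "real^'d \<Rightarrow> real"
  assumes \<tau>: "\<tau> ** \<sigma> = mat 1" and \<rho>: "\<rho> > 0"
    and u: "continuous_on UNIV u" and w: "continuous_on UNIV w"
    and subu: "\<And>\<Psi> D H x. C2_with \<Psi> D H \<Longrightarrow> x \<in> ball z \<rho> \<Longrightarrow> touches_above UNIV \<Psi> u x \<Longrightarrow>
        c1 \<le> ell \<sigma> (H x)"
    and subw: "\<And>\<Psi> D H x. C2_with \<Psi> D H \<Longrightarrow> x \<in> ball z \<rho> \<Longrightarrow> touches_above UNIV \<Psi> w x \<Longrightarrow>
        c2 \<le> ell \<sigma> (H x)"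
    and max: "\<And>x. x \<in> ball z \<rho> \<Longrightarrow> u x + w x \<le> u z + w z"
  shows "c1 + c2 \<le> 0"
proof -
  obtain N where N: "N > 0" "\<And>h. norm (\<tau> *v h) \<le> N * norm h"
    using linear_bounded_pos[OF matrix_vector_mul_linear[of \<tau>]] by auto
  define r where "r = min (\<rho>/2) (1 / N)"
  have r: "0 < r" "r < \<rho>" using \<rho> N by (auto simp: r_def)
  have sub_ball: "ball z r \<subseteq> ball z \<rho>" and sub_ball': "cball z r \<subseteq> ball z \<rho>" using r by auto
  have cell: "cball z r \<subseteq> cell \<tau> z"
  proof
    fix x assume "x \<in> cball z r"
    then have "norm (x - z) \<le> 1 / N" by (simp add: r_def dist_norm norm_minus_commute)
    have "\<bar>(\<tau> *v (x - z)) $ i\<bar> \<le> pi/2" for i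
    proof -
      have "\<bar>(\<tau> *v (x - z)) $ i\<bar> \<le> norm (\<tau> *v (x - z))" by (rule component_le_norm_cart)
      also have "\<dots> \<le> N * norm (x - z)" by (rule N)
      also have "\<dots> \<le> N * (1 / N)" using \<open>norm (x - z) \<le> 1 / N\<close> N(1) by (intro mult_left_mono) auto
      also have "\<dots> \<le> pi/2" using N(1) pi_ge_two by simp
      finally show ?thesis .
    qed
    then show "x \<in> cell \<tau> z" unfolding cell_def by blast
  qed
  obtain B0 where B0: "\<And>x. x \<in> cell \<tau> z \<Longrightarrow> \<bar>u x\<bar> \<le> B0" "\<And>x. x \<in> cell \<tau> z \<Longrightarrow> \<bar>w x\<bar> \<le> B0"
  proof -
    have "bounded (u ` cell \<tau> z)" "bounded (w ` cell \<tau> z)"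
      by (intro compact_imp_bounded compact_continuous_image compact_cell[OF \<tau>]
          continuous_on_subset[OF u] continuous_on_subset[OF w] subset_UNIV)+
    then obtain B1 B2 where "\<forall>x\<in>cell \<tau> z. \<bar>u x\<bar> \<le> B1" "\<forall>x\<in>cell \<tau> z. \<bar>w x\<bar> \<le> B2"
      unfolding bounded_iff by auto
    then show ?thesis by (intro that[of "max B1 B2"]) fastforce+
  qed
  define M where "M = u z + w z"
  define B where "B = 3 * B0 + 1"
  have zc: "z \<in> cell \<tau> z" using cell r by auto
  have "0 \<le> B0" using B0(1)[OF zc] by linarith
  define K where "K = 2 + 36 * ((2 * B + \<bar>c1\<bar>) / r ^ 4) * (ell \<sigma> (mat 1))\<^sup>2
      + 36 * ((2 * B + \<bar>c2\<bar>) / r ^ 4) * (ell \<sigma> (mat 1))\<^sup>2"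
  \<comment> \<open>The accuracy of the approximation of u is chosen as s squared, the order of the other errors.\<close>
  have est: "c1 + c2 \<le> K * s" if s: "0 < s" "s \<le> 1" for s
  proof -
    obtain P where P: "P \<in> cos_sums \<tau> z" "\<And>x. x \<in> cell \<tau> z \<Longrightarrow> \<bar>u x - P x\<bar> < s\<^sup>2"
      using cos_sums_dense[OF \<tau> continuous_on_subset[OF u], of z "s\<^sup>2"] s by auto
    have "s\<^sup>2 \<le> 1" using s by (simp add: power_le_one)
    then have PB: "\<bar>P x\<bar> \<le> B0 + 1" if "x \<in> cell \<tau> z" for x
      using P(2)[OF that] B0(1)[OF that] by linarith
    obtain U D H where U: "U \<in> cos_sums \<tau> z" "C2_with U D H" "\<And>x. U x - s * ell \<sigma> (H x) = P x"
      using cos_sums_resolvent[OF \<tau> s(1) P(1)] by blast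
    have UB: "\<bar>U x\<bar> \<le> B0 + 1" for x
      by (rule cos_sums_resolvent_bound[OF \<tau> s(1) U PB])
    have 1: "u z - U z \<le> s\<^sup>2 - s * c1 + 36 * ((2 * B + \<bar>c1\<bar>) / r ^ 4) * (ell \<sigma> (mat 1))\<^sup>2 * s\<^sup>2"
    proof (rule subsolution_below_resolvent[OF r(1) _ _ U(2) s])
      show "continuous_on (cball z r) u" by (rule continuous_on_subset[OF u]) simp
      show "c1 \<le> ell \<sigma> (H x)" if "C2_with \<Psi> D H" "x \<in> ball z r" "touches_above UNIV \<Psi> u x"
        for \<Psi> D H x using subu[OF that(1) _ that(3)] that(2) sub_ball by blast
      fix x assume x: "x \<in> cball z r"
      then have xc: "x \<in> cell \<tau> z" using cell by blast
      show "u x - s\<^sup>2 \<le> U x - s * ell \<sigma> (H x)" using P(2)[OF xc] U(3)[of x] by linarith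
      show "\<bar>u x\<bar> \<le> B" "\<bar>U x\<bar> \<le> B" using B0(1)[OF xc] UB[of x] \<open>0 \<le> B0\<close> by (auto simp: B_def)
    qed simp
    \<comment> \<open>M - U satisfies the resolvent inequality for w because w is at most M - u on the ball.\<close>
    have V: "C2_with (\<lambda>x. (-1) * U x + (0 \<bullet> x + M)) (\<lambda>x. (-1) *\<^sub>R D x + 0) (\<lambda>x. (-1) *\<^sub>R H x + 0)"
      by (rule C2_with_add[OF C2_with_scale[OF U(2)] C2_with_affine])
    have 2: "w z - ((-1) * U z + (0 \<bullet> z + M)) \<le>
        s\<^sup>2 - s * c2 + 36 * ((2 * B + \<bar>c2\<bar>) / r ^ 4) * (ell \<sigma> (mat 1))\<^sup>2 * s\<^sup>2"
    proof (rule subsolution_below_resolvent[OF r(1) _ _ V s])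
      show "continuous_on (cball z r) w" by (rule continuous_on_subset[OF w]) simp
      show "c2 \<le> ell \<sigma> (H x)" if "C2_with \<Psi> D H" "x \<in> ball z r" "touches_above UNIV \<Psi> w x"
        for \<Psi> D H x using subw[OF that(1) _ that(3)] that(2) sub_ball by blast
      fix x assume x: "x \<in> cball z r"
      then have xc: "x \<in> cell \<tau> z" using cell by blast
      have "u x + w x \<le> M" using max sub_ball' x by (auto simp: M_def)
      then show "w x - s\<^sup>2 \<le> (-1) * U x + (0 \<bullet> x + M) - s * ell \<sigma> ((-1) *\<^sub>R H x + 0)"
        using P(2)[OF xc] U(3)[of x] by (simp add: ell_minus)
      have "\<bar>M\<bar> \<le> 2 * B0" using B0[OF zc] by (auto simp: M_def)
      then show "\<bar>w x\<bar> \<le> B" "\<bar>(-1) * U x + (0 \<bullet> x + M)\<bar> \<le> B"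
        using B0(2)[OF xc] UB[of x] \<open>0 \<le> B0\<close> by (auto simp: B_def)
    qed simp
    have "s * (c1 + c2) \<le> s * (K * s)"
      using 1 2 by (simp add: M_def K_def algebra_simps power2_eq_square)
    then show ?thesis using s by simp
  qed
  show ?thesis
  proof (rule ccontr)
    assume c: "\<not> c1 + c2 \<le> 0"
    then have K: "0 < K" using est[of 1] by linarith
    define s where "s = min 1 ((c1 + c2) / (2 * K))"
    have "0 < s" "s \<le> 1" using c K by (auto simp: s_def)
    from est[OF this] have "c1 + c2 \<le> K * ((c1 + c2) / (2 * K))"
      using K by (smt (verit) mult_left_mono min.cobounded2 s_def)
    then show False using c K by simp
  qed
qed

section \<open>Sup-convolutions and doubling of variables\<close>

text \<open>
  The penalty is divided by \<open>e\<close>, so that two of them at the midpoint of \<open>x\<close> and \<open>y\<close> add up to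
  the doubling penalty \<open>|x - y|\<^sup>2 / (2 e)\<close>.
\<close>

definition sup_conv :: "real \<Rightarrow> (real^'d) set \<Rightarrow> (real^'d \<Rightarrow> real) \<Rightarrow> real^'d \<Rightarrow> real" where
  "sup_conv e S U z = (SUP x\<in>S. U x - (norm (x - z))\<^sup>2 / e)"

context
  fixes S :: "(real^'d) set" and U :: "real^'d \<Rightarrow> real" and e :: real
  assumes S: "compact S" "S \<noteq> {}" and U: "continuous_on S U" and e: "e > 0"
begin

lemma sup_conv_attained:
  obtains x where "x \<in> S" "sup_conv e S U z = U x - (norm (x - z))\<^sup>2 / e"
    "\<And>y. y \<in> S \<Longrightarrow> U y - (norm (y - z))\<^sup>2 / e \<le> U x - (norm (x - z))\<^sup>2 / e"
proof -
  obtain x where x: "x \<in> S"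
    "\<And>y. y \<in> S \<Longrightarrow> U y - (norm (y - z))\<^sup>2 / e \<le> U x - (norm (x - z))\<^sup>2 / e"
    using continuous_attains_sup[OF S, of "\<lambda>x. U x - (norm (x - z))\<^sup>2 / e"] U e
    by (force intro: continuous_intros)
  moreover have "sup_conv e S U z = U x - (norm (x - z))\<^sup>2 / e"
    unfolding sup_conv_def by (rule cSup_eq_maximum) (use x in auto)
  ultimately show ?thesis by (intro that)
qed

lemma sup_conv_ge: "x \<in> S \<Longrightarrow> U x - (norm (x - z))\<^sup>2 / e \<le> sup_conv e S U z"
  by (metis sup_conv_attained)

lemma continuous_sup_conv: "continuous_on UNIV (sup_conv e S U)"
proof -
  obtain B where B: "\<And>x. x \<in> S \<Longrightarrow> norm x \<le> B"
    using compact_imp_bounded[OF S(1)] by (auto simp: bounded_iff)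
  define K where "K z z' = (2 * B + norm z + norm z') / e * norm (z - z')" for z z' :: "real^'d"
  have le: "sup_conv e S U z - sup_conv e S U z' \<le> K z z'" for z z'
  proof -
    obtain x where x: "x \<in> S" "sup_conv e S U z = U x - (norm (x - z))\<^sup>2 / e"
      by (rule sup_conv_attained)
    have "(norm (x - z'))\<^sup>2 - (norm (x - z))\<^sup>2 =
        (norm (x - z') + norm (x - z)) * (norm (x - z') - norm (x - z))"
      by (simp add: power2_eq_square algebra_simps)
    also have "\<dots> \<le> (norm (x - z') + norm (x - z)) * norm (z - z')"
      using norm_triangle_ineq2[of "x - z'" "x - z"] by (intro mult_left_mono) auto
    also have "\<dots> \<le> (2 * B + norm z + norm z') * norm (z - z')"
    proof (rule mult_right_mono)
      show "norm (x - z') + norm (x - z) \<le> 2 * B + norm z + norm z'"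
        using norm_triangle_ineq4[of x z] norm_triangle_ineq4[of x z'] B[OF x(1)] by linarith
    qed simp
    finally have "((norm (x - z'))\<^sup>2 - (norm (x - z))\<^sup>2) / e \<le> K z z'"
      using e by (simp add: K_def divide_right_mono)
    then show ?thesis
      using x(2) sup_conv_ge[OF x(1), of z'] by (simp add: diff_divide_distrib)
  qed
  have "(sup_conv e S U \<longlongrightarrow> sup_conv e S U z) (at z)" for z
  proof -
    have "isCont (K z) z"
      unfolding K_def using e by (intro continuous_intros) auto
    then have "(K z \<longlongrightarrow> 0) (at z)" by (simp add: isCont_def K_def)
    moreover have "dist (sup_conv e S U z') (sup_conv e S U z) \<le> K z z'" for z'
    proof -
      have "K z' z = K z z'" by (simp add: K_def norm_minus_commute add_ac)
      then show ?thesis using le[of z z'] le[of z' z] unfolding dist_real_def by linarith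
    qed
    ultimately have "((\<lambda>z'. dist (sup_conv e S U z') (sup_conv e S U z)) \<longlongrightarrow> 0) (at z)"
      by - (rule Lim_null_comparison[where g = "K z"], simp_all)
    then show ?thesis by (simp add: tendsto_dist_iff[of _ "sup_conv e S U z"])
  qed
  then show ?thesis by (simp add: continuous_on_def)
qed

text \<open>
  The function \<open>y \<mapsto> U x - |x - y|\<^sup>2 / e\<close> touches the sup-convolution from below at \<open>z\<close>, which determines the
  gradient of a test function; the test function translated by \<open>z - x\<close> touches \<open>U\<close> at \<open>x\<close>.
\<close>

lemma sup_conv_touches:
  assumes \<Psi>: "C2_with \<Psi> D H" and t: "touches_above UNIV \<Psi> (sup_conv e S U) z"
    and x: "x \<in> S" "sup_conv e S U z = U x - (norm (x - z))\<^sup>2 / e"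
  shows "D z = (2 / e) *\<^sub>R (x - z)"
    and "touches_above S (\<lambda>y. \<Psi> (y + (z - x))) U x"
proof -
  obtain d where d: "d > 0" "\<And>y. y \<in> ball z d \<Longrightarrow> sup_conv e S U y - \<Psi> y \<le> sup_conv e S U z - \<Psi> z"
    using t by (auto simp: touches_above_def)
  have q: "C2_with (\<lambda>y. (-1/e) * (norm (y - x))\<^sup>2 + (-1) * \<Psi> y)
     (\<lambda>y. (-1/e) *\<^sub>R (2 *\<^sub>R (y - x)) + (-1) *\<^sub>R D y) (\<lambda>y. (-1/e) *\<^sub>R (2 *\<^sub>R mat 1) + (-1) *\<^sub>R H y)"
    by (intro C2_with_add C2_with_scale C2_with_square_norm \<Psi>)
  define g where "g = (-1/e) *\<^sub>R (2 *\<^sub>R (z - x)) + (-1) *\<^sub>R D z"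
  have "((\<lambda>y. (-1/e) * (norm (y - x))\<^sup>2 + (-1) * \<Psi> y) has_derivative (\<lambda>h. g \<bullet> h)) (at z)"
    using q unfolding C2_with_def g_def by blast
  moreover have "(-1/e) * (norm (y - x))\<^sup>2 + (-1) * \<Psi> y \<le> (-1/e) * (norm (z - x))\<^sup>2 + (-1) * \<Psi> z"
    if "y \<in> ball z d" for y
    using d(2)[OF that] sup_conv_ge[OF x(1), of y] x(2) by (simp add: norm_minus_commute)
  ultimately have "(\<lambda>h. g \<bullet> h) = (\<lambda>h. 0)"
    using d(1) by (intro differential_zero_maxmin[of z "ball z d"]) auto
  from fun_cong[OF this, of g] have "g = 0" by simp
  then show "D z = (2 / e) *\<^sub>R (x - z)"
    by (simp add: g_def algebra_simps)
  show "touches_above S (\<lambda>y. \<Psi> (y + (z - x))) U x"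
    unfolding touches_above_def
  proof (intro conjI exI[of _ d] ballI)
    fix y assume y: "y \<in> S \<inter> ball x d"
    then have "y + (z - x) \<in> ball z d" by (simp add: dist_norm algebra_simps)
    from d(2)[OF this] sup_conv_ge[of y "y + (z - x)"] y x(2)
    show "U y - \<Psi> (y + (z - x)) \<le> U x - \<Psi> (x + (z - x))"
      by (simp add: norm_minus_commute)
  qed (use d x in auto)
qed

text \<open>
  Limits of maximisers are maximisers, so a unique maximiser is stable.
\<close>

lemma sup_conv_maximizer_near:
  assumes uniq: "\<And>x. x \<in> S \<Longrightarrow> sup_conv e S U z0 = U x - (norm (x - z0))\<^sup>2 / e \<Longrightarrow> x = xh"
    and \<delta>: "\<delta> > 0"
  shows "\<exists>\<rho>>0. \<forall>z\<in>ball z0 \<rho>. \<forall>x\<in>S. sup_conv e S U z = U x - (norm (x - z))\<^sup>2 / e \<longrightarrow> dist x xh < \<delta>"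
proof (rule ccontr)
  assume "\<not> ?thesis"
  then have "\<exists>z x. z \<in> ball z0 (inverse (Suc n)) \<and> x \<in> S \<and>
      sup_conv e S U z = U x - (norm (x - z))\<^sup>2 / e \<and> \<not> dist x xh < \<delta>" for n
    by (meson inverse_positive_iff_positive of_nat_0_less_iff zero_less_Suc)
  then obtain Z X where ZX: "\<And>n. Z n \<in> ball z0 (inverse (Suc n))" "\<And>n. X n \<in> S"
      "\<And>n. sup_conv e S U (Z n) = U (X n) - (norm (X n - Z n))\<^sup>2 / e" "\<And>n. \<not> dist (X n) xh < \<delta>"
    by metis
  have "(\<lambda>n. dist (Z n) z0) \<longlonglongrightarrow> 0"
    by (rule tendsto_sandwich[OF _ _ tendsto_const LIMSEQ_inverse_real_of_nat])
      (use ZX(1) in \<open>auto simp: dist_commute less_imp_le intro!: always_eventually\<close>)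
  then have Z: "Z \<longlonglongrightarrow> z0" by (simp add: tendsto_dist_iff[of Z])
  obtain x r where x: "x \<in> S" and r: "strict_mono r" "(X \<circ> r) \<longlonglongrightarrow> x"
    by (rule seq_compactE[OF compact_imp_seq_compact[OF S(1)], of X]) (use ZX(2) in auto)
  have Zr: "(Z \<circ> r) \<longlonglongrightarrow> z0" by (rule LIMSEQ_subseq_LIMSEQ[OF Z r(1)])
  have "(\<lambda>n. U ((X \<circ> r) n) - (norm ((X \<circ> r) n - (Z \<circ> r) n))\<^sup>2 / e) \<longlonglongrightarrow> U x - (norm (x - z0))\<^sup>2 / e"
    by (intro tendsto_intros r Zr continuous_on_tendsto_compose[OF U]) (use x ZX(2) e in auto)
  moreover have "(\<lambda>n. sup_conv e S U ((Z \<circ> r) n)) \<longlonglongrightarrow> sup_conv e S U z0"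
    by (rule continuous_on_tendsto_compose[OF continuous_sup_conv Zr]) auto
  ultimately have "sup_conv e S U z0 = U x - (norm (x - z0))\<^sup>2 / e"
    by (intro LIMSEQ_unique) (simp_all add: ZX(3))
  with uniq x have "x = xh" by blast
  have "(\<lambda>n. dist ((X \<circ> r) n) xh) \<longlonglongrightarrow> dist x xh" by (intro tendsto_intros r)
  then have "\<delta> \<le> dist x xh" by (rule LIMSEQ_le_const) (use ZX(4) in \<open>auto simp: not_less\<close>)
  with \<open>x = xh\<close> \<delta> show False by simp
qed

text \<open>
  A differential inequality for \<open>U\<close> at points near \<open>xh\<close> and with gradients near
  \<open>2 (xh - z0) / e\<close> passes to the sup-convolution on a full neighbourhood of \<open>z0\<close>. That the
  inequality is needed only for such points and gradients allows the lower order terms to be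
  frozen.
\<close>

lemma sup_conv_subsolution:
  assumes uniq: "\<And>x. x \<in> S \<Longrightarrow> sup_conv e S U z0 = U x - (norm (x - z0))\<^sup>2 / e \<Longrightarrow> x = xh"
    and \<delta>: "\<delta> > 0"
    and sub: "\<And>\<Psi> D H x. C2_with \<Psi> D H \<Longrightarrow> touches_above S \<Psi> U x \<Longrightarrow> dist x xh < \<delta> \<Longrightarrow>
        dist (D x) ((2 / e) *\<^sub>R (xh - z0)) < \<delta> \<Longrightarrow> c \<le> ell \<sigma> (H x)"
  shows "\<exists>\<rho>>0. \<forall>\<Psi> D H. \<forall>z\<in>ball z0 \<rho>. C2_with \<Psi> D H \<longrightarrow> touches_above UNIV \<Psi> (sup_conv e S U) z \<longrightarrow>
      c \<le> ell \<sigma> (H z)"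
proof -
  \<comment> \<open>Errors in x and z enter the gradient 2 (x - z) / e with the factor 2 / e each.\<close>
  define \<gamma> where "\<gamma> = min \<delta> (\<delta> * e / 4)"
  have \<gamma>: "\<gamma> > 0" using \<delta> e by (simp add: \<gamma>_def)
  obtain \<rho> where \<rho>: "\<rho> > 0" "\<And>z x. z \<in> ball z0 \<rho> \<Longrightarrow> x \<in> S \<Longrightarrow>
      sup_conv e S U z = U x - (norm (x - z))\<^sup>2 / e \<Longrightarrow> dist x xh < \<gamma>"
    using sup_conv_maximizer_near[OF uniq \<gamma>] by blast
  show ?thesis
  proof (intro exI[of _ "min \<rho> \<gamma>"] conjI allI ballI impI)
    fix \<Psi> D H z
    assume z: "z \<in> ball z0 (min \<rho> \<gamma>)" and \<Psi>: "C2_with \<Psi> D H"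
      and t: "touches_above UNIV \<Psi> (sup_conv e S U) z"
    obtain x where x: "x \<in> S" "sup_conv e S U z = U x - (norm (x - z))\<^sup>2 / e"
      by (rule sup_conv_attained)
    have dx: "dist x xh < \<gamma>" using \<rho>(2)[OF _ x] z by simp
    have D: "D z = (2 / e) *\<^sub>R (x - z)" by (rule sup_conv_touches(1)[OF \<Psi> t x])
    have "dist (D z) ((2 / e) *\<^sub>R (xh - z0)) = (2 / e) * norm ((x - xh) - (z - z0))"
      unfolding D dist_norm scaleR_diff_right[symmetric] norm_scaleR using e by (simp add: algebra_simps)
    also have "\<dots> \<le> (2 / e) * (dist x xh + dist z z0)"
      unfolding dist_norm using e by (intro mult_left_mono norm_triangle_ineq4) auto
    also have "\<dots> < (2 / e) * (\<delta> * e / 4 + \<delta> * e / 4)"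
      using e dx z by (intro mult_strict_left_mono add_strict_mono) (auto simp: \<gamma>_def dist_commute)
    also have "\<dots> = \<delta>" using e by simp
    finally have "dist (D (x + (z - x))) ((2 / e) *\<^sub>R (xh - z0)) < \<delta>" by simp
    from sub[OF C2_with_translate[OF \<Psi>] sup_conv_touches(2)[OF \<Psi> t x] _ this] dx
    show "c \<le> ell \<sigma> (H z)" by (simp add: \<gamma>_def)
  qed (use \<rho> \<gamma> in auto)
qed

end

text \<open>
  A substitute for Ishii's lemma when the second-order operator has constant coefficients. By the
  parallelogram law the sum of the two sup-convolutions is maximal at the midpoint \<open>z0\<close>, and the
  maximisers defining them there are exactly \<open>xh\<close> and \<open>yh\<close>.
\<close>

lemma theorem_on_sums:
  fixes U V :: "real^'d \<Rightarrow> real"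
  assumes \<tau>: "\<tau> ** \<sigma> = mat 1" and S: "compact S" and U: "continuous_on S U" and V: "continuous_on S V"
    and e: "e > 0" and xy: "xh \<in> S" "yh \<in> S"
    and max: "\<And>x y. x \<in> S \<Longrightarrow> y \<in> S \<Longrightarrow>
        U x + V y - (norm (x - y))\<^sup>2 / (2 * e) \<le> U xh + V yh - (norm (xh - yh))\<^sup>2 / (2 * e)"
    and \<delta>: "\<delta> > 0"
    and subU: "\<And>\<Psi> D H x. C2_with \<Psi> D H \<Longrightarrow> touches_above S \<Psi> U x \<Longrightarrow> dist x xh < \<delta> \<Longrightarrow>
        dist (D x) ((1 / e) *\<^sub>R (xh - yh)) < \<delta> \<Longrightarrow> c1 \<le> ell \<sigma> (H x)"
    and subV: "\<And>\<Psi> D H y. C2_with \<Psi> D H \<Longrightarrow> touches_above S \<Psi> V y \<Longrightarrow> dist y yh < \<delta> \<Longrightarrow>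
        dist (D y) ((1 / e) *\<^sub>R (yh - xh)) < \<delta> \<Longrightarrow> c2 \<le> ell \<sigma> (H y)"
  shows "c1 + c2 \<le> 0"
proof -
  have ne: "S \<noteq> {}" using xy by auto
  define z0 where "z0 = (1/2) *\<^sub>R (xh + yh)"
  define u w where "u = sup_conv e S U" and "w = sup_conv e S V"
  define M where "M = U xh + V yh - (norm (xh - yh))\<^sup>2 / (2 * e)"
  have par: "(norm (x - z))\<^sup>2 / e + (norm (y - z))\<^sup>2 / e =
      (norm (x - y))\<^sup>2 / (2 * e) + 2 * (norm (z - (1/2) *\<^sub>R (x + y)))\<^sup>2 / e" for x y z :: "real^'d"
  proof -
    have "(norm (x - z))\<^sup>2 + (norm (y - z))\<^sup>2 = (norm (x - y))\<^sup>2 / 2 + 2 * (norm (z - (1/2) *\<^sub>R (x + y)))\<^sup>2"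
      unfolding power2_norm_eq_inner
      by (simp add: inner_diff_left inner_diff_right inner_add_left inner_add_right inner_commute)
        (simp add: field_simps)
    then show ?thesis using e by (simp add: field_simps)
  qed
  have le: "u z + w z \<le> M" for z
  proof -
    obtain x where x: "x \<in> S" "u z = U x - (norm (x - z))\<^sup>2 / e"
      unfolding u_def by (rule sup_conv_attained[OF S ne U e])
    obtain y where y: "y \<in> S" "w z = V y - (norm (y - z))\<^sup>2 / e"
      unfolding w_def by (rule sup_conv_attained[OF S ne V e])
    have "0 \<le> 2 * (norm (z - (1/2) *\<^sub>R (x + y)))\<^sup>2 / e" using e by simp
    then show ?thesis using max[OF x(1) y(1)] par[of x z y] x(2) y(2) by (simp add: M_def)
  qed
  have ge: "U xh - (norm (xh - z0))\<^sup>2 / e \<le> u z0" "V yh - (norm (yh - z0))\<^sup>2 / e \<le> w z0"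
    unfolding u_def w_def using sup_conv_ge[OF S ne U e xy(1)] sup_conv_ge[OF S ne V e xy(2)] by auto
  have M: "M = (U xh - (norm (xh - z0))\<^sup>2 / e) + (V yh - (norm (yh - z0))\<^sup>2 / e)"
    using par[of xh z0 yh] by (simp add: M_def z0_def)
  have z0: "u z0 = U xh - (norm (xh - z0))\<^sup>2 / e" "w z0 = V yh - (norm (yh - z0))\<^sup>2 / e"
    using le[of z0] ge M by linarith+
  \<comment> \<open>Equality in the parallelogram law forces any maximising pair at z0 to be centred at z0.\<close>
  have mid: "z0 = (1/2) *\<^sub>R (x + y)"
    if "x \<in> S" "y \<in> S" "u z0 = U x - (norm (x - z0))\<^sup>2 / e" "w z0 = V y - (norm (y - z0))\<^sup>2 / e" for x y
  proof -
    have "2 * (norm (z0 - (1/2) *\<^sub>R (x + y)))\<^sup>2 / e \<le> 0"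
      using par[of x z0 y] max[OF that(1,2)] that(3,4) z0 M unfolding M_def by linarith
    then show ?thesis using e by (simp add: divide_le_0_iff mult_le_0_iff)
  qed
  have uniqU: "x = xh" if "x \<in> S" "sup_conv e S U z0 = U x - (norm (x - z0))\<^sup>2 / e" for x
    using mid[OF that(1) xy(2) _ z0(2)] that(2) by (simp add: z0_def u_def)
  have uniqV: "y = yh" if "y \<in> S" "sup_conv e S V z0 = V y - (norm (y - z0))\<^sup>2 / e" for y
    using mid[OF xy(1) that(1) z0(1)] that(2) by (simp add: z0_def w_def)
  have p: "(2 / e) *\<^sub>R (xh - z0) = (1 / e) *\<^sub>R (xh - yh)" "(2 / e) *\<^sub>R (yh - z0) = (1 / e) *\<^sub>R (yh - xh)"
    by (simp_all add: z0_def algebra_simps flip: scaleR_add_left)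
  have "\<exists>\<rho>>0. \<forall>\<Psi> D H. \<forall>z\<in>ball z0 \<rho>. C2_with \<Psi> D H \<longrightarrow> touches_above UNIV \<Psi> u z \<longrightarrow>
      c1 \<le> ell \<sigma> (H z)"
    unfolding u_def
  proof (rule sup_conv_subsolution[OF S ne U e _ \<delta>])
    show "x = xh" if "x \<in> S" "sup_conv e S U z0 = U x - (norm (x - z0))\<^sup>2 / e" for x
      by (rule uniqU[OF that])
  qed (unfold p, rule subU)
  then obtain \<rho>1 where \<rho>1: "\<rho>1 > 0" "\<And>\<Psi> D H z. z \<in> ball z0 \<rho>1 \<Longrightarrow> C2_with \<Psi> D H \<Longrightarrow>
      touches_above UNIV \<Psi> u z \<Longrightarrow> c1 \<le> ell \<sigma> (H z)" by blast
  have "\<exists>\<rho>>0. \<forall>\<Psi> D H. \<forall>z\<in>ball z0 \<rho>. C2_with \<Psi> D H \<longrightarrow> touches_above UNIV \<Psi> w z \<longrightarrow>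
      c2 \<le> ell \<sigma> (H z)"
    unfolding w_def
  proof (rule sup_conv_subsolution[OF S ne V e _ \<delta>])
    show "x = yh" if "x \<in> S" "sup_conv e S V z0 = V x - (norm (x - z0))\<^sup>2 / e" for x
      by (rule uniqV[OF that])
  qed (unfold p, rule subV)
  then obtain \<rho>2 where \<rho>2: "\<rho>2 > 0" "\<And>\<Psi> D H z. z \<in> ball z0 \<rho>2 \<Longrightarrow> C2_with \<Psi> D H \<Longrightarrow>
      touches_above UNIV \<Psi> w z \<Longrightarrow> c2 \<le> ell \<sigma> (H z)" by blast
  show ?thesis
  proof (rule linear_comparison[OF \<tau>, where u = u and w = w and z = z0 and \<rho> = "min \<rho>1 \<rho>2"])
    show "continuous_on UNIV u" "continuous_on UNIV w"
      unfolding u_def w_def by (rule continuous_sup_conv[OF S ne U e] continuous_sup_conv[OF S ne V e])+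
    show "u x + w x \<le> u z0 + w z0" for x using le[of x] z0 M by simp
  qed (use \<rho>1 \<rho>2 in auto)
qed

text \<open>
  The usual penalisation: the maximising pairs converge to \<open>(x0, x0)\<close> and the penalty to zero.
\<close>

lemma doubling_maxima:
  fixes U V :: "real^'d \<Rightarrow> real"
  assumes S: "compact S" and U: "continuous_on S U" and V: "continuous_on S V"
    and x0: "x0 \<in> S" and strict: "\<And>x. x \<in> S \<Longrightarrow> x \<noteq> x0 \<Longrightarrow> U x + V x < U x0 + V x0"
    and \<delta>: "\<delta> > 0"
  obtains e xh yh where "e > 0" "xh \<in> S" "yh \<in> S"
    "\<And>x y. x \<in> S \<Longrightarrow> y \<in> S \<Longrightarrow>
        U x + V y - (norm (x - y))\<^sup>2 / (2 * e) \<le> U xh + V yh - (norm (xh - yh))\<^sup>2 / (2 * e)"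
    "dist xh x0 < \<delta>" "dist yh x0 < \<delta>" "(norm (xh - yh))\<^sup>2 / e < \<delta>"
proof -
  define E where "E n = inverse (real (Suc n))" for n
  have E: "E n > 0" for n by (simp add: E_def)
  have "\<exists>x y. x \<in> S \<and> y \<in> S \<and> (\<forall>x'\<in>S. \<forall>y'\<in>S.
      U x' + V y' - (norm (x' - y'))\<^sup>2 / (2 * E n) \<le> U x + V y - (norm (x - y))\<^sup>2 / (2 * E n))" for n
  proof -
    have "continuous_on (S \<times> S) (\<lambda>q. U (fst q) + V (snd q) - (norm (fst q - snd q))\<^sup>2 / (2 * E n))"
      by (intro continuous_intros continuous_on_compose2[OF U] continuous_on_compose2[OF V])
        (use E[of n] in auto)
    from continuous_attains_sup[OF compact_Times[OF S S] _ this] x0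
    obtain q where "q \<in> S \<times> S" "\<forall>q'\<in>S \<times> S. U (fst q') + V (snd q') - (norm (fst q' - snd q'))\<^sup>2 / (2 * E n)
        \<le> U (fst q) + V (snd q) - (norm (fst q - snd q))\<^sup>2 / (2 * E n)" by blast
    then show ?thesis by (intro exI[of _ "fst q"] exI[of _ "snd q"]) auto
  qed
  then obtain X Y where XY: "\<And>n. X n \<in> S" "\<And>n. Y n \<in> S" and
    max: "\<And>n x y. x \<in> S \<Longrightarrow> y \<in> S \<Longrightarrow>
      U x + V y - (norm (x - y))\<^sup>2 / (2 * E n) \<le> U (X n) + V (Y n) - (norm (X n - Y n))\<^sup>2 / (2 * E n)"
    by metis
  obtain q r where q: "q \<in> S \<times> S" and r: "strict_mono r" "((\<lambda>n. (X n, Y n)) \<circ> r) \<longlonglongrightarrow> q"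
    by (rule seq_compactE[OF compact_imp_seq_compact[OF compact_Times[OF S S]], of "\<lambda>n. (X n, Y n)"])
      (use XY in auto)
  obtain x y where xy: "q = (x, y)" "x \<in> S" "y \<in> S" using q by auto
  have lim: "(\<lambda>n. X (r n)) \<longlonglongrightarrow> x" "(\<lambda>n. Y (r n)) \<longlonglongrightarrow> y"
    using tendsto_fst[OF r(2)] tendsto_snd[OF r(2)] by (auto simp: xy o_def)
  define G where "G n = U (X n) + V (Y n) - (U x0 + V x0)" for n
  have G: "(norm (X n - Y n))\<^sup>2 / (2 * E n) \<le> G n" for n
    using max[OF x0 x0, of n] by (simp add: G_def)
  have G0: "0 \<le> G n" for n 
    using E[of n] by (intro order_trans[OF _ G]) simp
  have limG: "(\<lambda>n. G (r n)) \<longlonglongrightarrow> U x + V y - (U x0 + V x0)"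
    unfolding G_def
    by (intro tendsto_intros continuous_on_tendsto_compose[OF U] continuous_on_tendsto_compose[OF V] lim)
      (use XY xy in auto)
  have "(\<lambda>n. E (r n)) \<longlonglongrightarrow> 0"
    using LIMSEQ_subseq_LIMSEQ[OF LIMSEQ_inverse_real_of_nat r(1)] by (simp add: E_def o_def)
  then have "(\<lambda>n. G (r n) * (2 * E (r n))) \<longlonglongrightarrow> (U x + V y - (U x0 + V x0)) * (2 * 0)"
    by (intro tendsto_intros limG)
  moreover have "(norm (X n - Y n))\<^sup>2 \<le> G n * (2 * E n)" for n
    using G[of n] E[of n] by (simp add: pos_divide_le_eq)
  moreover have "(\<lambda>n. (norm (X (r n) - Y (r n)))\<^sup>2) \<longlonglongrightarrow> (norm (x - y))\<^sup>2"
    by (intro tendsto_intros lim)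
  ultimately have "(norm (x - y))\<^sup>2 \<le> 0"
    by (intro LIMSEQ_le[of _ _ "\<lambda>n. G (r n) * (2 * E (r n))"]) auto
  then have "x = y" by simp
  have "0 \<le> U x + V y - (U x0 + V x0)"
    by (rule LIMSEQ_le_const[OF limG]) (use G0 in auto)
  with strict[OF xy(2)] \<open>x = y\<close> have "x = x0" by fastforce
  have "eventually (\<lambda>n. dist (X (r n)) x0 < \<delta>) sequentially" "eventually (\<lambda>n. dist (Y (r n)) x0 < \<delta>) sequentially"
    using lim \<delta> \<open>x = y\<close> \<open>x = x0\<close> by (auto dest: tendstoD)
  moreover have "eventually (\<lambda>n. G (r n) < \<delta> / 2) sequentially"
    using order_tendstoD(2)[OF limG, of "\<delta>/2"] \<delta> \<open>x = y\<close> \<open>x = x0\<close> by simp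
  ultimately have "eventually (\<lambda>n. dist (X (r n)) x0 < \<delta> \<and> dist (Y (r n)) x0 < \<delta> \<and> G (r n) < \<delta> / 2) sequentially"
    by eventually_elim auto
  then obtain n where n: "dist (X (r n)) x0 < \<delta>" "dist (Y (r n)) x0 < \<delta>" "G (r n) < \<delta> / 2"
    by (auto simp: eventually_sequentially)
  have "(norm (X (r n) - Y (r n)))\<^sup>2 / E (r n) = 2 * ((norm (X (r n) - Y (r n)))\<^sup>2 / (2 * E (r n)))" by simp
  also have "\<dots> < \<delta>" using G[of "r n"] n(3) by linarith
  finally show ?thesis by (intro that[OF E XY max n(1,2)])
qed

section \<open>Convex domains with a Neumann condition\<close>

text \<open>
  \<open>\<nu>\<close> is the gradient of the defining function, the inward unit normal on the frontier.
\<close>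

locale convex_domain =
  fixes G :: "(real^'d) set" and \<phi> :: "real^'d \<Rightarrow> real" and \<nu> :: "real^'d \<Rightarrow> real^'d"
  assumes bounded: "bounded G" and convex: "convex G" and G_open: "open G"
    and \<phi>: "\<And>x. (\<phi> has_derivative (\<lambda>h. \<nu> x \<bullet> h)) (at x)" and \<nu>_cont: "continuous_on UNIV \<nu>"
    and G_eq: "G = {x. \<phi> x > 0}" and frontier_eq: "frontier G = {x. \<phi> x = 0}"
    and \<nu>_unit: "\<And>x. x \<in> frontier G \<Longrightarrow> norm (\<nu> x) = 1"
begin

lemma closure_cases: "x \<in> closure G \<Longrightarrow> x \<in> G \<or> x \<in> frontier G"
  using G_open by (simp add: frontier_def interior_open)

lemma frontier_closure: "x \<in> frontier G \<Longrightarrow> x \<in> closure G"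
  by (simp add: frontier_def)

lemma frontier_not_in: "x \<in> frontier G \<Longrightarrow> x \<notin> G"
  using G_open by (simp add: frontier_def interior_open)

lemma compact_closure_G: "compact (closure G)"
  using bounded by (simp add: compact_closure)

text \<open>
  \<open>\<phi>\<close> vanishes at \<open>x\<close> and is nonnegative on the segment from \<open>x\<close> to \<open>y\<close>.
\<close>

lemma inward_normal:
  assumes x: "x \<in> frontier G" and y: "y \<in> closure G"
  shows "0 \<le> \<nu> x \<bullet> (y - x)"
proof (rule ccontr)
  assume neg: "\<not> 0 \<le> \<nu> x \<bullet> (y - x)"
  have l: "((\<lambda>t. x + t *\<^sub>R (y - x)) has_derivative (\<lambda>h. h *\<^sub>R (y - x))) (at 0)"
    by (auto intro!: derivative_eq_intros)
  have "(\<phi> has_derivative (\<lambda>h. \<nu> x \<bullet> h)) (at (x + 0 *\<^sub>R (y - x)))" using \<phi>[of x] by simp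
  from has_derivative_compose[OF l this]
  have "((\<lambda>t. \<phi> (x + t *\<^sub>R (y - x))) has_real_derivative \<nu> x \<bullet> (y - x)) (at 0)"
    by (simp add: has_field_derivative_def mult_commute_abs)
  from DERIV_neg_dec_right[OF this] neg obtain d where d: "d > 0"
    "\<And>t. 0 < t \<Longrightarrow> t < d \<Longrightarrow> \<phi> (x + t *\<^sub>R (y - x)) < \<phi> x" by auto
  define t where "t = min 1 (d/2)"
  have t: "0 < t" "t < d" "t \<le> 1" using d(1) by (auto simp: t_def)
  have "x + t *\<^sub>R (y - x) = (1 - t) *\<^sub>R x + t *\<^sub>R y" by (simp add: algebra_simps)
  also have "\<dots> \<in> closure G"
    using t by (intro convexD_alt[OF convex_closure[OF convex]] frontier_closure x y) auto
  finally have "x + t *\<^sub>R (y - x) \<in> closure G" .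
  then have "0 \<le> \<phi> (x + t *\<^sub>R (y - x))"
    using closure_cases by (fastforce simp: G_eq frontier_eq[unfolded G_eq])
  moreover have "\<phi> x = 0" using x frontier_eq by auto
  ultimately show False using d(2)[OF t(1,2)] by simp
qed

text \<open>
  An interior point can be moved a little against the normal without leaving \<open>G\<close>.
\<close>

lemma inward_normal_strict:
  assumes x: "x \<in> frontier G" and y: "y \<in> G"
  shows "0 < \<nu> x \<bullet> (y - x)"
proof -
  obtain t where t: "t > 0" "cball y t \<subseteq> G" using G_open y open_contains_cball by blast
  have "dist y (y - t *\<^sub>R \<nu> x) \<le> t" using t(1) \<nu>_unit[OF x] by (simp add: dist_norm)
  then have "y - t *\<^sub>R \<nu> x \<in> closure G" using t(2) closure_subset[of G] by (auto simp: subset_iff)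
  from inward_normal[OF x this]
  have "t * (\<nu> x \<bullet> \<nu> x) \<le> \<nu> x \<bullet> (y - x)" by (simp add: algebra_simps inner_diff_right)
  moreover have "\<nu> x \<bullet> \<nu> x = 1" using \<nu>_unit[OF x] by (simp add: norm_eq_1)
  ultimately show ?thesis using t(1) by simp
qed

text \<open>
  The generalised Neumann problem with a general first-order term \<open>F\<close>. Supersolutions are covered by
  passing to \<open>- v\<close> with \<open>- F x (- p)\<close>, \<open>- g\<close> and \<open>- lam\<close>, so each estimate is proved for
  subsolutions only.
\<close>

definition neumann_subsolution ::
    "real^'d^'d \<Rightarrow> (real^'d \<Rightarrow> real^'d \<Rightarrow> real) \<Rightarrow> (real^'d \<Rightarrow> real) \<Rightarrow> (real^'d \<Rightarrow> real) \<Rightarrow> real \<Rightarrow> bool" where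
  "neumann_subsolution \<sigma> F g v lam \<longleftrightarrow>
     (\<forall>\<Psi> D H x. C2_with \<Psi> D H \<longrightarrow> touches_above (closure G) \<Psi> v x \<longrightarrow>
        (x \<in> frontier G \<and> 0 \<le> \<nu> x \<bullet> D x + g x) \<or> lam \<le> ell \<sigma> (H x) + F x (D x))"

text \<open>
  The effect of a pair \<open>(xh, yh)\<close> from the doubling of variables on one of the two functions. By \<open>bd\<close> the terms
  \<open>\<Phi>/2\<close> and \<open>l \<bullet> x\<close> make the boundary inequality fail by the margin \<open>\<theta>\<close>; for the latter
  \<open>l = g x0 \<nu> x0\<close> is the choice in mind, which cancels \<open>g\<close> near \<open>x0\<close>. Because \<open>G\<close> is convex, the
  penalisation gradient does not help the boundary inequality beyond an error controlled by \<open>\<delta>\<close>. So the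
  equation itself holds at the touching points near \<open>xh\<close>, and continuity freezes its lower order
  terms at \<open>xh\<close>.
\<close>

lemma perturbed_subsolution:
  assumes sub: "neumann_subsolution \<sigma> F g v lam"
    and F: "continuous_on (closure G \<times> UNIV) (\<lambda>q. F (fst q) (snd q))"
    and \<Phi>: "C2_with \<Phi> D H"
    and xh: "xh \<in> closure G" "dist xh x0 < r" and yh: "yh \<in> closure G"
    and e: "e > 0" and \<epsilon>: "\<epsilon> > 0" and \<theta>: "\<theta> > 0"
    and bd: "\<And>x. x \<in> frontier G \<Longrightarrow> dist x x0 < r \<Longrightarrow> \<nu> x \<bullet> D x / 2 + (g x - \<nu> x \<bullet> l) \<le> - \<theta>"
    and p: "p = (1 / e) *\<^sub>R (xh - yh)"
  shows "\<exists>\<delta>>0. \<forall>\<Psi> D\<Psi> H\<Psi> x. C2_with \<Psi> D\<Psi> H\<Psi> \<longrightarrow>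
      touches_above (closure G \<inter> cball x0 r) \<Psi> (\<lambda>x. v x - \<Phi> x / 2 + l \<bullet> x) x \<longrightarrow>
      dist x xh < \<delta> \<longrightarrow> dist (D\<Psi> x) p < \<delta> \<longrightarrow>
      lam - ell \<sigma> (H xh) / 2 - F xh (p + (1/2) *\<^sub>R D xh - l) - \<epsilon> \<le> ell \<sigma> (H\<Psi> x)"
proof -
  define h where "h q = ell \<sigma> (H (fst q)) / 2 + F (fst q) (snd q + (1/2) *\<^sub>R D (fst q) - l)" for q
  have "continuous_on (closure G \<times> UNIV) h"
    unfolding h_def
  proof (intro continuous_on_add continuous_on_divide continuous_on_const continuous_on_ell)
    show "continuous_on (closure G \<times> UNIV) (\<lambda>q. H (fst q))"
      by (rule continuous_on_compose2[OF C2_with_cont(3)[OF \<Phi>, of UNIV]]) (auto intro: continuous_intros)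
    have "continuous_on (closure G \<times> UNIV) (\<lambda>q. D (fst q))"
      by (rule continuous_on_compose2[OF C2_with_cont(2)[OF \<Phi>, of UNIV]]) (auto intro: continuous_intros)
    then have "continuous_on (closure G \<times> UNIV) (\<lambda>q. (fst q, snd q + (1/2) *\<^sub>R D (fst q) - l))"
      by (intro continuous_intros)
    moreover have "(\<lambda>q. (fst q, snd q + (1/2) *\<^sub>R D (fst q) - l)) ` (closure G \<times> UNIV) \<subseteq> closure G \<times> UNIV"
      by auto
    ultimately have "continuous_on (closure G \<times> UNIV)
        (\<lambda>q. F (fst (fst q, snd q + (1/2) *\<^sub>R D (fst q) - l)) (snd (fst q, snd q + (1/2) *\<^sub>R D (fst q) - l)))"
      by (rule continuous_on_compose2[OF F])
    then show "continuous_on (closure G \<times> UNIV) (\<lambda>q. F (fst q) (snd q + (1/2) *\<^sub>R D (fst q) - l))"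
      by simp
  qed auto
  then obtain \<gamma> where \<gamma>: "\<gamma> > 0" "\<And>q. q \<in> closure G \<times> UNIV \<Longrightarrow> dist q (xh, p) < \<gamma> \<Longrightarrow> dist (h q) (h (xh, p)) < \<epsilon>"
    using \<epsilon> xh(1) unfolding continuous_on_iff by (metis UNIV_I mem_Sigma_iff)
  define \<delta> where "\<delta> = Min {\<gamma>/2, r - dist xh x0, \<theta> / (2 * (1 + 1/e))}"
  have "0 < 2 * (1 + 1/e)" using e by (intro mult_pos_pos add_pos_pos) auto
  then have "0 < \<delta>" using \<gamma>(1) xh \<theta> by (simp add: \<delta>_def)
  moreover have "\<delta> \<le> \<gamma>/2" "\<delta> \<le> r - dist xh x0" "\<delta> \<le> \<theta> / (2 * (1 + 1/e))"
    unfolding \<delta>_def by (rule Min_le; simp)+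
  ultimately have \<delta>: "0 < \<delta>" "\<delta> \<le> \<gamma>/2" "\<delta> \<le> r - dist xh x0" "\<delta> \<le> \<theta> / (2 * (1 + 1/e))"
    by blast+
  have small: "\<delta> + \<delta> / e < \<theta>"
  proof -
    have "\<delta> * (2 * (1 + 1/e)) \<le> \<theta>" using \<delta>(4) \<open>0 < 2 * (1 + 1/e)\<close> by (simp add: pos_le_divide_eq)
    then have le: "2 * (\<delta> + \<delta> / e) \<le> \<theta>" by (simp add: algebra_simps)
    have "0 < \<delta> + \<delta> / e" using \<delta>(1) e by (intro add_pos_pos divide_pos_pos)
    then have "\<delta> + \<delta> / e < 2 * (\<delta> + \<delta> / e)" unfolding mult_2 by (rule less_add_same_cancel1[THEN iffD2])
    then show ?thesis using le by (rule less_le_trans)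
  qed
  show ?thesis
  proof (intro exI[of _ \<delta>] conjI allI impI \<delta>(1))
    fix \<Psi> D\<Psi> H\<Psi> x
    assume \<Psi>: "C2_with \<Psi> D\<Psi> H\<Psi>"
      and t: "touches_above (closure G \<inter> cball x0 r) \<Psi> (\<lambda>x. v x - \<Phi> x / 2 + l \<bullet> x) x"
      and x: "dist x xh < \<delta>" and Dx: "dist (D\<Psi> x) p < \<delta>"
    have xr: "dist x x0 < r" using dist_triangle[of x x0 xh] x \<delta>(3) by linarith
    obtain d where d: "d > 0" "x \<in> closure G" "\<And>y. y \<in> closure G \<inter> cball x0 r \<inter> ball x d \<Longrightarrow>
        v y - \<Phi> y / 2 + l \<bullet> y - \<Psi> y \<le> v x - \<Phi> x / 2 + l \<bullet> x - \<Psi> x"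
      using t unfolding touches_above_def by blast
    have C: "C2_with (\<lambda>y. \<Psi> y + 1/2 * \<Phi> y + (- l \<bullet> y + 0)) (\<lambda>y. D\<Psi> y + (1/2) *\<^sub>R D y + - l)
        (\<lambda>y. H\<Psi> y + (1/2) *\<^sub>R H y + 0)"
      by (intro C2_with_add C2_with_scale C2_with_affine \<Psi> \<Phi>)
    have "touches_above (closure G) (\<lambda>y. \<Psi> y + 1/2 * \<Phi> y + (- l \<bullet> y + 0)) v x"
      unfolding touches_above_def
    proof (intro conjI exI[of _ "min d (r - dist x x0)"] ballI d(2))
      fix y assume y: "y \<in> closure G \<inter> ball x (min d (r - dist x x0))"
      then have "dist x0 y \<le> r" using dist_triangle[of x0 y x] by (simp add: dist_commute)
      then show "v y - (\<Psi> y + 1/2 * \<Phi> y + (- l \<bullet> y + 0)) \<le> v x - (\<Psi> x + 1/2 * \<Phi> x + (- l \<bullet> x + 0))"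
        using d(3)[of y] y by simp
    qed (use d(1) xr in auto)
    with sub C have "(x \<in> frontier G \<and> 0 \<le> \<nu> x \<bullet> (D\<Psi> x + (1/2) *\<^sub>R D x + - l) + g x) \<or>
        lam \<le> ell \<sigma> (H\<Psi> x + (1/2) *\<^sub>R H x + 0) + F x (D\<Psi> x + (1/2) *\<^sub>R D x + - l)"
      unfolding neumann_subsolution_def by blast
    moreover have "\<not> (x \<in> frontier G \<and> 0 \<le> \<nu> x \<bullet> (D\<Psi> x + (1/2) *\<^sub>R D x + - l) + g x)"
    proof
      assume *: "x \<in> frontier G \<and> 0 \<le> \<nu> x \<bullet> (D\<Psi> x + (1/2) *\<^sub>R D x + - l) + g x"
      then have xf: "x \<in> frontier G" by simp
      have 1: "\<nu> x \<bullet> (D\<Psi> x - p) \<le> \<delta>"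
        using norm_cauchy_schwarz[of "\<nu> x" "D\<Psi> x - p"] \<nu>_unit[OF xf] Dx by (simp add: dist_norm)
      have "\<nu> x \<bullet> (xh - x) \<le> \<delta>"
        using norm_cauchy_schwarz[of "\<nu> x" "xh - x"] \<nu>_unit[OF xf] x
        by (simp add: dist_norm norm_minus_commute)
      moreover have "0 \<le> \<nu> x \<bullet> (yh - x)" by (rule inward_normal[OF xf yh])
      ultimately have "\<nu> x \<bullet> (xh - yh) \<le> \<delta>" by (simp add: inner_diff_right)
      then have "(\<nu> x \<bullet> (xh - yh)) / e \<le> \<delta> / e" using e by (simp add: divide_right_mono)
      then have 2: "\<nu> x \<bullet> p \<le> \<delta> / e" by (simp add: p)
      have "\<nu> x \<bullet> (D\<Psi> x + (1/2) *\<^sub>R D x + - l) + g x =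
          \<nu> x \<bullet> (D\<Psi> x - p) + \<nu> x \<bullet> p + (\<nu> x \<bullet> D x / 2 + (g x - \<nu> x \<bullet> l))"
        by (simp add: inner_diff_right inner_add_right)
      also have "\<dots> < 0" using 1 2 bd[OF xf xr] small by linarith
      finally show False using * by simp
    qed
    ultimately have "lam \<le> ell \<sigma> (H\<Psi> x + (1/2) *\<^sub>R H x + 0) + F x (D\<Psi> x + (1/2) *\<^sub>R D x + - l)"
      by blast
    then have le: "lam \<le> ell \<sigma> (H\<Psi> x) + h (x, D\<Psi> x)"
      by (simp add: h_def ell_add ell_scale)
    have "dist (h (x, D\<Psi> x)) (h (xh, p)) < \<epsilon>"
    proof (rule \<gamma>(2))
      have "dist (x, D\<Psi> x) (xh, p) \<le> dist x xh + dist (D\<Psi> x) p"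
        unfolding dist_prod_def by (simp add: sqrt_sum_squares_le_sum)
      then show "dist (x, D\<Psi> x) (xh, p) < \<gamma>" using x Dx \<delta>(2) by linarith
    qed (use d(2) in auto)
    then have "h (x, D\<Psi> x) < h (xh, p) + \<epsilon>" unfolding dist_real_def by linarith
    with le have "lam - h (xh, p) - \<epsilon> \<le> ell \<sigma> (H\<Psi> x)" by linarith
    then show "lam - ell \<sigma> (H xh) / 2 - F xh (p + (1/2) *\<^sub>R D xh - l) - \<epsilon> \<le> ell \<sigma> (H\<Psi> x)"
      by (simp add: h_def)
  qed
qed

end

section \<open>The difference of two solutions\<close>

text \<open>
  Uniform ellipticity: \<open>|\<sigma>\<^sup>T z|\<close> is bounded below by a multiple of \<open>|z|\<close>.
\<close>

lemma ell_outer_lower_bound: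
  fixes \<sigma> \<tau> :: "real^'d^'d"
  assumes \<tau>: "\<tau> ** \<sigma> = mat 1"
  obtains c where "c > 0" "\<And>z. c * (norm z)\<^sup>2 \<le> ell \<sigma> (outer z)"
proof -
  obtain N where N: "N > 0" "\<And>y. norm (transpose \<tau> *v y) \<le> N * norm y"
    using linear_bounded_pos[OF matrix_vector_mul_linear[of "transpose \<tau>"]] by auto
  have "1 / (2 * N\<^sup>2) * (norm z)\<^sup>2 \<le> ell \<sigma> (outer z)" for z
  proof -
    have "transpose \<tau> ** transpose \<sigma> = mat 1"
      using \<tau> matrix_left_right_inverse[of \<tau> \<sigma>] by (metis matrix_transpose_mul transpose_mat)
    then have "z = transpose \<tau> *v (transpose \<sigma> *v z)"
      by (simp only: matrix_vector_mul_assoc matrix_vector_mul_lid)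
    then have "(norm z)\<^sup>2 \<le> (N * norm (transpose \<sigma> *v z))\<^sup>2"
      using N(2)[of "transpose \<sigma> *v z"] by (intro power_mono) auto
    moreover have "(norm (transpose \<sigma> *v z))\<^sup>2 = 2 * ell \<sigma> (outer z)"
      unfolding ell_outer power2_norm_eq_inner inner_vec_def
      by (simp add: matrix_vector_mult_def transpose_def column_def power2_eq_square mult_ac)
    ultimately show ?thesis using N(1) by (simp add: power_mult_distrib pos_divide_le_eq mult_ac)
  qed
  then show ?thesis using N(1) by (intro that[of "1 / (2 * N\<^sup>2)"]) auto
qed

text \<open>
  A subsolution \<open>v1\<close> with constant \<open>lam1\<close> and a supersolution \<open>v2\<close> with constant \<open>lam2\<close>.
  \<open>F_mod\<close> is the modulus of continuity in \<open>x\<close> that the doubling of variables requires: the distance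
  is weighted by the size of the gradient.
\<close>

locale neumann_pair = convex_domain G \<phi> \<nu>
  for G :: "(real^'d) set" and \<phi> \<nu> +
  fixes \<sigma> \<tau> :: "real^'d^'d" and F :: "real^'d \<Rightarrow> real^'d \<Rightarrow> real" and K :: real
    and g v1 v2 :: "real^'d \<Rightarrow> real" and lam1 lam2 :: real
  assumes \<tau>: "\<tau> ** \<sigma> = mat 1"
    and F_lip: "\<And>x p q. x \<in> closure G \<Longrightarrow> \<bar>F x p - F x q\<bar> \<le> K * norm (p - q)"
    and F_mod: "\<And>\<kappa>. \<kappa> > 0 \<Longrightarrow> \<exists>\<delta>>0. \<forall>x\<in>closure G. \<forall>y\<in>closure G. \<forall>p.
        (1 + norm p) * norm (x - y) < \<delta> \<longrightarrow> \<bar>F x p - F y p\<bar> \<le> \<kappa>"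
    and K: "0 \<le> K"
    and g_cont: "continuous_on (closure G) g"
    and v1_cont: "continuous_on (closure G) v1" and v2_cont: "continuous_on (closure G) v2"
    and sub: "neumann_subsolution \<sigma> F g v1 lam1"
    and super: "neumann_subsolution \<sigma> (\<lambda>x p. - F x (- p)) (\<lambda>x. - g x) (\<lambda>x. - v2 x) (- lam2)"
begin

lemma F_cont: "continuous_on (closure G \<times> UNIV) (\<lambda>q. F (fst q) (snd q))"
  unfolding continuous_on_iff
proof (intro ballI allI impI)
  fix q0 :: "(real^'d) \<times> (real^'d)" and \<epsilon> :: real
  assume q0: "q0 \<in> closure G \<times> UNIV" and \<epsilon>: "\<epsilon> > 0"
  define p where "p = snd q0"
  obtain \<delta> where \<delta>: "\<delta> > 0" "\<And>x y p. x \<in> closure G \<Longrightarrow> y \<in> closure G \<Longrightarrow>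
      (1 + norm p) * norm (x - y) < \<delta> \<Longrightarrow> \<bar>F x p - F y p\<bar> \<le> \<epsilon> / 2"
    using F_mod[of "\<epsilon>/2"] \<epsilon> by auto
  have pos: "0 < 1 + norm p" "0 < K + 1" using norm_ge_zero[of p] K by linarith+
  define \<gamma> where "\<gamma> = min (\<delta> / (1 + norm p)) (\<epsilon> / (2 * (K + 1)))"
  have "\<gamma> > 0" using \<delta> \<epsilon> pos by (simp add: \<gamma>_def)
  moreover have "dist (F (fst q) (snd q)) (F (fst q0) (snd q0)) < \<epsilon>"
    if q: "q \<in> closure G \<times> UNIV" and d: "dist q q0 < \<gamma>" for q
  proof -
    have x: "norm (fst q - fst q0) < \<gamma>" and P: "norm (snd q - p) < \<gamma>"
      using dist_fst_le[of q q0] dist_snd_le[of q q0] d by (auto simp: dist_norm p_def)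
    have "(1 + norm p) * norm (fst q - fst q0) < (1 + norm p) * (\<delta> / (1 + norm p))"
      using x pos by (intro mult_strict_left_mono) (auto simp: \<gamma>_def)
    also have "\<dots> = \<delta>" using pos by simp
    finally have 1: "\<bar>F (fst q) p - F (fst q0) p\<bar> \<le> \<epsilon> / 2"
      using q q0 by (intro \<delta>(2)) auto
    have "(K + 1) * norm (snd q - p) < (K + 1) * (\<epsilon> / (2 * (K + 1)))"
      using P pos by (intro mult_strict_left_mono) (auto simp: \<gamma>_def)
    also have "\<dots> = \<epsilon> / 2" using pos(2) by (simp add: field_simps)
    finally have "K * norm (snd q - p) < \<epsilon> / 2"
      using norm_ge_zero[of "snd q - p"] by (simp add: distrib_right del: norm_ge_zero)
    then have 2: "\<bar>F (fst q) (snd q) - F (fst q) p\<bar> < \<epsilon> / 2"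
      using F_lip[of "fst q" "snd q" p] q by auto
    show ?thesis using 1 2 unfolding dist_real_def p_def by linarith
  qed
  ultimately show "\<exists>d>0. \<forall>q\<in>closure G \<times> UNIV. dist q q0 < d \<longrightarrow>
      dist (F (fst q) (snd q)) (F (fst q0) (snd q0)) < \<epsilon>" by blast
qed

text \<open>
  At \<open>x0\<close> itself the difference \<open>g - g x0 (\<nu> \<bullet> \<nu> x0)\<close> vanishes because \<open>\<nu> x0\<close> has norm one.
\<close>

lemma boundary_margin:
  assumes \<Phi>: "C2_with \<Phi> D H" and x0: "x0 \<in> closure G"
    and bd: "x0 \<in> frontier G \<Longrightarrow> \<nu> x0 \<bullet> D x0 < 0"
  obtains r \<theta> where "r > 0" "\<theta> > 0"
    "\<And>x. x \<in> frontier G \<Longrightarrow> dist x x0 < r \<Longrightarrow>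
       \<nu> x \<bullet> D x / 2 + \<bar>g x - \<nu> x \<bullet> (g x0 *\<^sub>R \<nu> x0)\<bar> \<le> - \<theta>"
proof (cases "x0 \<in> frontier G")
  case True
  define h where "h x = \<nu> x \<bullet> D x / 2 + \<bar>g x - \<nu> x \<bullet> (g x0 *\<^sub>R \<nu> x0)\<bar>" for x
  have "continuous_on (closure G) h"
    unfolding h_def by (intro continuous_intros continuous_on_subset[OF \<nu>_cont] g_cont C2_with_cont[OF \<Phi>]) auto
  moreover have "\<nu> x0 \<bullet> \<nu> x0 = 1" using \<nu>_unit[OF True] by (simp add: norm_eq_1)
  then have h0: "h x0 = \<nu> x0 \<bullet> D x0 / 2" by (simp add: h_def)
  then have "h x0 < 0" using bd[OF True] by simp
  ultimately obtain r where r: "r > 0" "\<And>x. x \<in> closure G \<Longrightarrow> dist x x0 < r \<Longrightarrow> dist (h x) (h x0) < - h x0 / 2"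
    using x0 unfolding continuous_on_iff by (metis half_gt_zero neg_0_less_iff_less)
  show ?thesis
  proof (rule that[OF r(1), of "- h x0 / 2"])
    fix x assume "x \<in> frontier G" "dist x x0 < r"
    from r(2)[OF frontier_closure[OF this(1)] this(2)]
    show "\<nu> x \<bullet> D x / 2 + \<bar>g x - \<nu> x \<bullet> (g x0 *\<^sub>R \<nu> x0)\<bar> \<le> - (- h x0 / 2)"
      unfolding h_def[of x, symmetric] dist_real_def by linarith
  qed (use \<open>h x0 < 0\<close> in simp)
next
  case False
  then have "x0 \<in> G" using closure_cases x0 by blast
  then obtain r where r: "r > 0" "ball x0 r \<subseteq> G" using G_open open_contains_ball by blast
  then have "x \<notin> frontier G" if "dist x x0 < r" for x
    using frontier_not_in that by (auto simp: dist_commute)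
  then show ?thesis using that[OF r(1), of 1] by auto
qed

text \<open>
  Doubling of variables for \<open>U + V = v1 - v2 - \<Phi>\<close>. Each of the two functions receives half of \<open>\<Phi>\<close>, since each
  has to violate its boundary condition strictly, and a linear term, with opposite signs, that compensates
  the inhomogeneity \<open>g\<close> at \<open>x0\<close>. The two constants \<open>c1\<close>, \<open>c2\<close> are the
  equations with first-order terms frozen at the maximising pair; their sum is positive by the
  strict inequality for \<open>\<Phi>\<close>, because the gradients entering them differ by the mean of the two values
  of \<open>D\<close> only.
\<close>

lemma no_strict_touching:
  assumes \<Phi>: "C2_with \<Phi> D H" and x0: "x0 \<in> closure G"
    and r0: "r0 > 0" and max: "\<And>x. x \<in> closure G \<Longrightarrow> dist x x0 < r0 \<Longrightarrow> x \<noteq> x0 \<Longrightarrow>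
        v1 x - v2 x - \<Phi> x < v1 x0 - v2 x0 - \<Phi> x0"
    and bd: "x0 \<in> frontier G \<Longrightarrow> \<nu> x0 \<bullet> D x0 < 0"
    and int: "ell \<sigma> (H x0) + K * norm (D x0) < lam1 - lam2"
  shows False
proof -
  define \<kappa> where "\<kappa> = (lam1 - lam2 - (ell \<sigma> (H x0) + K * norm (D x0))) / 2"
  have \<kappa>: "\<kappa> > 0" using int by (simp add: \<kappa>_def)
  have "continuous_on UNIV (\<lambda>x. ell \<sigma> (H x) + K * norm (D x))"
    by (intro continuous_intros continuous_on_ell C2_with_cont[OF \<Phi>])
  then obtain r1 where r1: "r1 > 0" "\<And>x. dist x x0 < r1 \<Longrightarrow>
      dist (ell \<sigma> (H x) + K * norm (D x)) (ell \<sigma> (H x0) + K * norm (D x0)) < \<kappa>"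
    using \<kappa> unfolding continuous_on_iff by (metis UNIV_I)
  have int': "ell \<sigma> (H x) + K * norm (D x) < lam1 - lam2 - \<kappa>" if "dist x x0 < r1" for x
  proof -
    have "2 * \<kappa> = lam1 - lam2 - (ell \<sigma> (H x0) + K * norm (D x0))" by (simp add: \<kappa>_def)
    then show ?thesis using r1(2)[OF that] unfolding dist_real_def by linarith
  qed
  define l where "l = g x0 *\<^sub>R \<nu> x0"
  obtain r2 \<theta> where r2: "r2 > 0" and \<theta>: "\<theta> > 0" and margin:
    "\<And>x. x \<in> frontier G \<Longrightarrow> dist x x0 < r2 \<Longrightarrow> \<nu> x \<bullet> D x / 2 + \<bar>g x - \<nu> x \<bullet> l\<bar> \<le> - \<theta>"
    unfolding l_def by (rule boundary_margin[OF \<Phi> x0 bd]) auto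
  define r where "r = Min {r0/2, r1/2, r2/2}"
  have r: "r > 0" "r < r0" "r < r1" "r < r2" using r0 r1(1) r2 by (auto simp: r_def min_def)
  define S where "S = closure G \<inter> cball x0 r"
  have S: "compact S" unfolding S_def by (intro closed_Int_compact) auto
  have SG: "S \<subseteq> closure G" by (simp add: S_def)
  define U V where "U x = v1 x - \<Phi> x / 2 + l \<bullet> x" and "V x = - v2 x - \<Phi> x / 2 + (- l) \<bullet> x" for x
  have U: "continuous_on S U" and V: "continuous_on S V"
    unfolding U_def V_def
    by (intro continuous_intros C2_with_cont[OF \<Phi>] continuous_on_subset[OF v1_cont SG]
        continuous_on_subset[OF v2_cont SG]; simp)+
  have x0S: "x0 \<in> S" using x0 r by (simp add: S_def)
  have strict: "U x + V x < U x0 + V x0" if "x \<in> S" "x \<noteq> x0" for x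
  proof -
    have "dist x x0 < r0" using that r by (simp add: S_def dist_commute)
    from max[OF _ this that(2)] that(1) show ?thesis by (simp add: U_def V_def S_def)
  qed
  have "bounded (D ` S)" by (intro compact_imp_bounded compact_continuous_image C2_with_cont[OF \<Phi>] S)
  then obtain BD where BD: "\<And>x. x \<in> S \<Longrightarrow> norm (D x) \<le> BD" by (auto simp: bounded_iff)
  have "0 \<le> BD" using BD[OF x0S] norm_ge_zero order_trans by blast
  obtain \<mu> where \<mu>: "\<mu> > 0" "\<And>x y p. x \<in> closure G \<Longrightarrow> y \<in> closure G \<Longrightarrow>
      (1 + norm p) * norm (x - y) < \<mu> \<Longrightarrow> \<bar>F x p - F y p\<bar> \<le> \<kappa> / 4"
    using F_mod[of "\<kappa>/4"] \<kappa> by auto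
  \<comment> \<open>Q bounds the weighted distance (1 + |q2|) |xh - yh| in units of the accuracy of the doubling.\<close>
  define Q where "Q = 4 + 2 * BD + 2 * norm l"
  have Q: "Q > 0" using \<open>0 \<le> BD\<close> norm_ge_zero[of l] unfolding Q_def by linarith
  define \<delta> where "\<delta> = min r (\<mu> / Q)"
  have \<delta>: "\<delta> > 0" "\<delta> \<le> r" "\<delta> * Q \<le> \<mu>" using r \<mu>(1) Q by (auto simp: \<delta>_def min_def field_simps)
  obtain e xh yh where e: "e > 0" and xy: "xh \<in> S" "yh \<in> S" and
    dmax: "\<And>x y. x \<in> S \<Longrightarrow> y \<in> S \<Longrightarrow>
        U x + V y - (norm (x - y))\<^sup>2 / (2 * e) \<le> U xh + V yh - (norm (xh - yh))\<^sup>2 / (2 * e)"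
    and near: "dist xh x0 < \<delta>" "dist yh x0 < \<delta>" and pen: "(norm (xh - yh))\<^sup>2 / e < \<delta>"
    using doubling_maxima[OF S U V x0S strict \<delta>(1)] by blast
  define p q where "p = (1 / e) *\<^sub>R (xh - yh)" and "q = (1 / e) *\<^sub>R (yh - xh)"
  have qp: "q = - p" by (simp add: p_def q_def algebra_simps)
  have xG: "xh \<in> closure G" "yh \<in> closure G" using xy SG by auto
  have near': "dist xh x0 < r" "dist yh x0 < r" using near \<delta>(2) by auto
  have F_cont': "continuous_on (closure G \<times> UNIV) (\<lambda>q. - F (fst q) (- snd q))"
  proof -
    have "continuous_on (closure G \<times> UNIV) (\<lambda>q :: (real^'d) \<times> (real^'d). (fst q, - snd q))"
      by (intro continuous_intros)
    moreover have "(\<lambda>q. (fst q, - snd q)) ` (closure G \<times> UNIV) \<subseteq> closure G \<times> UNIV" by auto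
    ultimately have "continuous_on (closure G \<times> UNIV) (\<lambda>q. F (fst (fst q, - snd q)) (snd (fst q, - snd q)))"
      by (rule continuous_on_compose2[OF F_cont])
    then show ?thesis by (intro continuous_on_minus) simp
  qed
  define c1 c2 where "c1 = lam1 - ell \<sigma> (H xh) / 2 - F xh (p + (1/2) *\<^sub>R D xh - l) - \<kappa> / 8"
    and "c2 = - lam2 - ell \<sigma> (H yh) / 2 - (- F yh (- (q + (1/2) *\<^sub>R D yh - (- l)))) - \<kappa> / 8"
  have bd1: "\<nu> x \<bullet> D x / 2 + (g x - \<nu> x \<bullet> l) \<le> - \<theta>"
    and bd2: "\<nu> x \<bullet> D x / 2 + (- g x - \<nu> x \<bullet> (- l)) \<le> - \<theta>"
    if "x \<in> frontier G" "dist x x0 < r" for x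
    using margin[OF that(1)] that(2) r(4) by (auto simp: abs_if split: if_splits)
  obtain \<delta>1 where \<delta>1: "\<delta>1 > 0" "\<And>\<Psi> D\<Psi> H\<Psi> x. C2_with \<Psi> D\<Psi> H\<Psi> \<Longrightarrow> touches_above S \<Psi> U x \<Longrightarrow>
      dist x xh < \<delta>1 \<Longrightarrow> dist (D\<Psi> x) p < \<delta>1 \<Longrightarrow> c1 \<le> ell \<sigma> (H\<Psi> x)"
    using perturbed_subsolution[OF sub F_cont \<Phi> xG(1) near'(1) xG(2) e _ \<theta> bd1 p_def, of "\<kappa>/8"] \<kappa>
    unfolding c1_def U_def[abs_def] S_def by auto
  obtain \<delta>2 where \<delta>2: "\<delta>2 > 0" "\<And>\<Psi> D\<Psi> H\<Psi> x. C2_with \<Psi> D\<Psi> H\<Psi> \<Longrightarrow> touches_above S \<Psi> V x \<Longrightarrow>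
      dist x yh < \<delta>2 \<Longrightarrow> dist (D\<Psi> x) q < \<delta>2 \<Longrightarrow> c2 \<le> ell \<sigma> (H\<Psi> x)"
    using perturbed_subsolution[OF super F_cont' \<Phi> xG(2) near'(2) xG(1) e _ \<theta> bd2 q_def, of "\<kappa>/8"] \<kappa>
    unfolding c2_def V_def[abs_def] S_def by auto
  have "c1 + c2 \<le> 0"
  proof (rule theorem_on_sums[OF \<tau> S U V e xy dmax, where \<delta> = "min \<delta>1 \<delta>2"])
    show "c1 \<le> ell \<sigma> (H\<Psi> x)" if "C2_with \<Psi> D\<Psi> H\<Psi>" "touches_above S \<Psi> U x" "dist x xh < min \<delta>1 \<delta>2"
      "dist (D\<Psi> x) ((1 / e) *\<^sub>R (xh - yh)) < min \<delta>1 \<delta>2" for \<Psi> D\<Psi> H\<Psi> x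
      using \<delta>1(2)[OF that(1,2)] that(3,4) by (simp add: p_def)
    show "c2 \<le> ell \<sigma> (H\<Psi> x)" if "C2_with \<Psi> D\<Psi> H\<Psi>" "touches_above S \<Psi> V x" "dist x yh < min \<delta>1 \<delta>2"
      "dist (D\<Psi> x) ((1 / e) *\<^sub>R (yh - xh)) < min \<delta>1 \<delta>2" for \<Psi> D\<Psi> H\<Psi> x
      using \<delta>2(2)[OF that(1,2)] that(3,4) by (simp add: q_def)
  qed (use \<delta>1 \<delta>2 in auto)
  moreover have "0 < c1 + c2"
  proof -
    \<comment> \<open>The gradients at which F is evaluated in c1 and c2.\<close>
    define q1 q2 where "q1 = p + (1/2) *\<^sub>R D xh - l" and "q2 = p - (1/2) *\<^sub>R D yh - l"
    have q2: "- (q + (1/2) *\<^sub>R D yh - (- l)) = q2" by (simp add: q2_def qp)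
    have "norm (q1 - q2) = norm ((1/2) *\<^sub>R (D xh + D yh))"
      by (simp add: q1_def q2_def scaleR_add_right)
    also have "\<dots> \<le> (norm (D xh) + norm (D yh)) / 2"
      using norm_triangle_ineq[of "D xh" "D yh"] by simp
    finally have "K * norm (q1 - q2) \<le> K * ((norm (D xh) + norm (D yh)) / 2)"
      using K by (rule mult_left_mono)
    then have 1: "F xh q1 - F xh q2 \<le> K * norm (D xh) / 2 + K * norm (D yh) / 2"
      using F_lip[OF xG(1), of q1 q2] by (simp add: field_simps)
    have "norm (xh - yh) \<le> dist xh x0 + dist yh x0"
      unfolding dist_norm[symmetric] by (rule dist_triangle2)
    then have n: "norm (xh - yh) \<le> 2 * \<delta>" using near by linarith
    have "norm q2 \<le> norm p + BD / 2 + norm l"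
      using norm_triangle_ineq4[of "p - (1/2) *\<^sub>R D yh" l] norm_triangle_ineq4[of p "(1/2) *\<^sub>R D yh"]
        BD[OF xy(2)] by (simp add: q2_def)
    then have "(1 + norm q2) * norm (xh - yh) \<le> (1 + BD / 2 + norm l + norm p) * norm (xh - yh)"
      by (intro mult_right_mono) auto
    also have "\<dots> = (1 + BD / 2 + norm l) * norm (xh - yh) + (norm (xh - yh))\<^sup>2 / e"
    proof -
      have "norm p = norm (xh - yh) / e" using e by (simp add: p_def)
      then show ?thesis by (simp add: distrib_right power2_eq_square)
    qed
    also have "\<dots> < (1 + BD / 2 + norm l) * (2 * \<delta>) + \<delta>"
      using n pen \<open>0 \<le> BD\<close> by (intro add_le_less_mono mult_left_mono) auto
    also have "\<dots> \<le> \<delta> * Q"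
      using \<delta>(1) \<open>0 \<le> BD\<close> by (simp add: Q_def algebra_simps)
    finally have "(1 + norm q2) * norm (xh - yh) < \<mu>" using \<delta>(3) by linarith
    from \<mu>(2)[OF xG this] have 2: "F xh q2 - F yh q2 \<le> \<kappa> / 4" by linarith
    have "ell \<sigma> (H xh) + K * norm (D xh) < lam1 - lam2 - \<kappa>"
      "ell \<sigma> (H yh) + K * norm (D yh) < lam1 - lam2 - \<kappa>"
      using int' near' r by auto
    then show ?thesis
      unfolding c1_def c2_def q2 q1_def[symmetric] using 1 2 \<kappa> by linarith
  qed
  ultimately show False by simp
qed

text \<open>
  A small multiple of \<open>|x - x0|\<^sup>2\<close> makes the maximum strict without changing the gradient of
  \<open>\<Phi>\<close> at \<open>x0\<close>.
\<close>

lemma difference_subsolution: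
  assumes \<Phi>: "C2_with \<Phi> D H" and t: "touches_above (closure G) \<Phi> (\<lambda>x. v1 x - v2 x) x0"
    and bd: "x0 \<in> frontier G \<Longrightarrow> \<nu> x0 \<bullet> D x0 < 0"
  shows "lam1 - lam2 \<le> ell \<sigma> (H x0) + K * norm (D x0)"
proof (rule ccontr)
  assume "\<not> ?thesis"
  then have gap: "0 < lam1 - lam2 - (ell \<sigma> (H x0) + K * norm (D x0))" by simp
  obtain r where r: "r > 0" "x0 \<in> closure G" "\<And>x. x \<in> closure G \<inter> ball x0 r \<Longrightarrow>
      v1 x - v2 x - \<Phi> x \<le> v1 x0 - v2 x0 - \<Phi> x0"
    using t unfolding touches_above_def by blast
  define T where "T = ell \<sigma> (mat 1)"
  have T: "0 \<le> T" unfolding T_def by (rule ell_mat_1_nonneg)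
  define \<beta> where "\<beta> = (lam1 - lam2 - (ell \<sigma> (H x0) + K * norm (D x0))) / (2 * (T + 1))"
  have \<beta>: "\<beta> > 0" using gap T by (simp add: \<beta>_def)
  have C: "C2_with (\<lambda>x. \<Phi> x + \<beta> * (norm (x - x0))\<^sup>2) (\<lambda>x. D x + \<beta> *\<^sub>R (2 *\<^sub>R (x - x0)))
      (\<lambda>x. H x + \<beta> *\<^sub>R (2 *\<^sub>R mat 1))"
    by (intro C2_with_add C2_with_scale C2_with_square_norm \<Phi>)
  show False
  proof (rule no_strict_touching[OF C r(2,1)])
    fix x assume x: "x \<in> closure G" "dist x x0 < r" "x \<noteq> x0"
    then have "0 < \<beta> * (norm (x - x0))\<^sup>2" using \<beta> by simp
    then show "v1 x - v2 x - (\<Phi> x + \<beta> * (norm (x - x0))\<^sup>2) <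
        v1 x0 - v2 x0 - (\<Phi> x0 + \<beta> * (norm (x0 - x0))\<^sup>2)"
      using r(3)[of x] x by (simp add: dist_commute)
  next
    have "\<beta> * (2 * (T + 1)) = lam1 - lam2 - (ell \<sigma> (H x0) + K * norm (D x0))"
      using T by (simp add: \<beta>_def)
    then show "ell \<sigma> (H x0 + \<beta> *\<^sub>R (2 *\<^sub>R mat 1)) + K * norm (D x0 + \<beta> *\<^sub>R (2 *\<^sub>R (x0 - x0))) < lam1 - lam2"
      using \<beta> by (simp add: ell_add ell_scale T_def[symmetric] algebra_simps)
  qed (use bd in auto)
qed

end

section \<open>The strong maximum principle\<close>

context neumann_pair
begin

text \<open>
  Hopf's barrier \<open>h x = exp (- \<alpha> |x - y|\<^sup>2)\<close>: for large \<open>\<alpha>\<close>, \<open>- \<epsilon> h\<close> violates the differential inequality of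
  \<open>difference_subsolution\<close> away from \<open>y\<close>, and near \<open>x0\<close> its gradient points outward
  on the boundary. For small \<open>\<epsilon>\<close> it nevertheless touches the difference near \<open>x0\<close>, since on the sphere around
  \<open>x0\<close> the sum of the difference and \<open>\<epsilon> h\<close> does not exceed its value at \<open>x0\<close>.
\<close>

lemma hopf_barrier:
  assumes x0: "x0 \<in> closure G" and M: "v1 x0 - v2 x0 = M"
    and le: "\<And>x. x \<in> closure G \<Longrightarrow> v1 x - v2 x \<le> M"
    and y: "y \<noteq> x0" "\<And>x. x \<in> closure G \<Longrightarrow> dist y x \<le> dist y x0 \<Longrightarrow> v1 x - v2 x = M \<Longrightarrow> x = x0"
    and inward: "x0 \<in> frontier G \<Longrightarrow> 0 < \<nu> x0 \<bullet> (y - x0)"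
    and lam: "lam2 \<le> lam1"
  shows False
proof -
  define R where "R = dist y x0"
  have R: "R > 0" using y(1) by (simp add: R_def)
  obtain c where c: "c > 0" "\<And>z. c * (norm z)\<^sup>2 \<le> ell \<sigma> (outer z)"
    using ell_outer_lower_bound[OF \<tau>] by blast
  define T where "T = ell \<sigma> (mat 1)"
  have T: "0 \<le> T" unfolding T_def by (rule ell_mat_1_nonneg)
  define \<alpha> where "\<alpha> = (2 * T + 3 * K * R + 1) / (c * R\<^sup>2)"
  have "0 < 2 * T + 3 * K * R + 1" using T K R by (intro add_nonneg_pos add_nonneg_nonneg) auto
  then have \<alpha>: "\<alpha> > 0" "\<alpha> * (c * R\<^sup>2) = 2 * T + 3 * K * R + 1" using c R by (auto simp: \<alpha>_def)
  define h where "h x = exp (- \<alpha> * (norm (x - y))\<^sup>2)" for x :: "real^'d"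
  define w where "w x = v1 x - v2 x" for x
  have w_cont: "continuous_on (closure G) w"
    unfolding w_def by (intro continuous_intros v1_cont v2_cont)
  have h_cont: "continuous_on A h" for A unfolding h_def by (intro continuous_intros)
  obtain \<rho> where \<rho>: "\<rho> > 0" "\<rho> \<le> R / 2" "\<And>x. x \<in> frontier G \<Longrightarrow> dist x x0 < \<rho> \<Longrightarrow> 0 < \<nu> x \<bullet> (y - x)"
  proof (cases "x0 \<in> frontier G")
    case True
    have "continuous_on UNIV (\<lambda>x. \<nu> x \<bullet> (y - x))" by (intro continuous_intros \<nu>_cont)
    then obtain d where d: "d > 0" "\<And>x. dist x x0 < d \<Longrightarrow> dist (\<nu> x \<bullet> (y - x)) (\<nu> x0 \<bullet> (y - x0)) < \<nu> x0 \<bullet> (y - x0)"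
      using inward[OF True] unfolding continuous_on_iff by (metis UNIV_I)
    show ?thesis
    proof (rule that[of "min d (R/2)"])
      show "0 < \<nu> x \<bullet> (y - x)" if "dist x x0 < min d (R/2)" for x
        using d(2)[of x] that unfolding dist_real_def by auto
    qed (use d R in auto)
  next
    case False
    then have "x0 \<in> G" using closure_cases x0 by blast
    then obtain d where d: "d > 0" "ball x0 d \<subseteq> G" using G_open open_contains_ball by blast
    show ?thesis
    proof (rule that[of "min d (R/2)"])
      show "0 < \<nu> x \<bullet> (y - x)" if "x \<in> frontier G" "dist x x0 < min d (R/2)" for x
        using d(2) frontier_not_in[OF that(1)] that(2) by (auto simp: dist_commute)
    qed (use d R in auto)
  qed
  define S where "S = closure G \<inter> cball x0 \<rho>"
  have S: "compact S" "S \<subseteq> closure G" "x0 \<in> S"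
    using x0 \<rho> by (auto simp: S_def intro: closed_Int_compact)
  \<comment> \<open>The part of the small sphere on which the barrier is not below its value at x0.\<close>
  define Z where "Z = closure G \<inter> (sphere x0 \<rho> \<inter> cball y R)"
  obtain \<epsilon> where \<epsilon>: "\<epsilon> > 0" "\<And>x. x \<in> Z \<Longrightarrow> w x \<le> M - \<epsilon>"
  proof (cases "Z = {}")
    case False
    have "compact Z" unfolding Z_def by (intro closed_Int_compact) auto
    then obtain z where z: "z \<in> Z" "\<And>x. x \<in> Z \<Longrightarrow> w x \<le> w z"
      using continuous_attains_sup[OF _ False, of w] continuous_on_subset[OF w_cont, of Z]
      by (auto simp: Z_def)
    have "w z \<noteq> M"
    proof
      assume "w z = M"
      then have "z = x0" using y(2)[of z] z(1) by (simp add: Z_def w_def R_def)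
      then show False using z(1) \<rho>(1) by (simp add: Z_def)
    qed
    then have "w z < M" using le[of z] z(1) by (simp add: w_def Z_def)
    then show ?thesis using z(2) by (intro that[of "M - w z"]) auto
  qed (use that[of 1] in auto)
  have rim: "w x + \<epsilon> * h x \<le> w x0 + \<epsilon> * h x0" if x: "x \<in> S" "dist x0 x = \<rho>" for x
  proof (cases "x \<in> Z")
    case True
    have "\<epsilon> * h x \<le> \<epsilon>" using \<epsilon>(1) \<alpha>(1) by (simp add: h_def mult_left_le)
    moreover have "0 < \<epsilon> * h x0" using \<epsilon>(1) by (simp add: h_def)
    ultimately show ?thesis using \<epsilon>(2)[OF True] M by (simp add: w_def)
  next
    case False
    then have "R \<le> norm (x - y)" using x by (simp add: Z_def S_def dist_norm norm_minus_commute)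
    then have "(norm (x0 - y))\<^sup>2 \<le> (norm (x - y))\<^sup>2"
      using R by (intro power_mono) (auto simp: R_def dist_norm norm_minus_commute)
    then have "\<epsilon> * h x \<le> \<epsilon> * h x0" using \<epsilon>(1) \<alpha>(1) by (simp add: h_def)
    then show ?thesis using le[of x] x M by (simp add: w_def S_def)
  qed
  obtain m where m: "m \<in> S" "dist x0 m < \<rho>" "\<And>x. x \<in> S \<Longrightarrow> w x + \<epsilon> * h x \<le> w m + \<epsilon> * h m"
  proof -
    obtain m where m: "m \<in> S" "\<And>x. x \<in> S \<Longrightarrow> w x + \<epsilon> * h x \<le> w m + \<epsilon> * h m"
    proof -
      have "continuous_on S (\<lambda>x. w x + \<epsilon> * h x)"
        by (intro continuous_intros continuous_on_subset[OF w_cont S(2)] h_cont)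
      from continuous_attains_sup[OF S(1) _ this] S(3) that show ?thesis by blast
    qed
    show ?thesis
    proof (cases "dist x0 m = \<rho>")
      case True
      show ?thesis using that[OF S(3)] rim[OF m(1) True] m(2) \<rho>(1) by fastforce
    next
      case False
      then show ?thesis using that[OF m(1) _ m(2)] m(1) by (simp add: S_def)
    qed
  qed
  define k where "k = \<epsilon> * (\<alpha> * h m)"
  have k: "k > 0" using \<epsilon>(1) \<alpha>(1) by (simp add: k_def h_def)
  have C: "C2_with (\<lambda>x. - \<epsilon> * exp (- \<alpha> * (norm (x - y))\<^sup>2))
     (\<lambda>x. (\<epsilon> * \<alpha> * exp (- \<alpha> * (norm (x - y))\<^sup>2)) *\<^sub>R (2 *\<^sub>R (x - y)))
     (\<lambda>x. (- \<epsilon> * \<alpha>\<^sup>2 * exp (- \<alpha> * (norm (x - y))\<^sup>2)) *\<^sub>R outer (2 *\<^sub>R (x - y)) +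
       (\<epsilon> * \<alpha> * exp (- \<alpha> * (norm (x - y))\<^sup>2)) *\<^sub>R (2 *\<^sub>R mat 1))"
    by (rule C2_with_compose[OF C2_with_square_norm, where k = "\<lambda>t. - \<epsilon> * exp (- \<alpha> * t)"
          and k' = "\<lambda>t. \<epsilon> * \<alpha> * exp (- \<alpha> * t)" and k'' = "\<lambda>t. - \<epsilon> * \<alpha>\<^sup>2 * exp (- \<alpha> * t)"])
      (auto intro!: derivative_eq_intros continuous_intros simp: power2_eq_square)
  have "lam1 - lam2 \<le> ell \<sigma> ((- \<epsilon> * \<alpha>\<^sup>2 * exp (- \<alpha> * (norm (m - y))\<^sup>2)) *\<^sub>R outer (2 *\<^sub>R (m - y)) +
       (\<epsilon> * \<alpha> * exp (- \<alpha> * (norm (m - y))\<^sup>2)) *\<^sub>R (2 *\<^sub>R mat 1)) +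
      K * norm ((\<epsilon> * \<alpha> * exp (- \<alpha> * (norm (m - y))\<^sup>2)) *\<^sub>R (2 *\<^sub>R (m - y)))"
  proof (rule difference_subsolution[OF C])
    show "touches_above (closure G) (\<lambda>x. - \<epsilon> * exp (- \<alpha> * (norm (x - y))\<^sup>2)) (\<lambda>x. v1 x - v2 x) m"
      unfolding touches_above_def
    proof (intro conjI exI[of _ "\<rho> - dist x0 m"] ballI)
      fix x assume x: "x \<in> closure G \<inter> ball m (\<rho> - dist x0 m)"
      then have "x \<in> S" using dist_triangle[of x0 x m] by (simp add: S_def)
      from m(3)[OF this]
      show "v1 x - v2 x - - \<epsilon> * exp (- \<alpha> * (norm (x - y))\<^sup>2) \<le> v1 m - v2 m - - \<epsilon> * exp (- \<alpha> * (norm (m - y))\<^sup>2)"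
        by (simp add: w_def h_def)
    qed (use m S(2) in auto)
    assume "m \<in> frontier G"
    then have "0 < \<nu> m \<bullet> (y - m)" using \<rho>(3) m(2) by (simp add: dist_commute)
    then have "\<nu> m \<bullet> (m - y) < 0" by (simp add: inner_diff_right)
    moreover have "0 < \<epsilon> * \<alpha> * exp (- \<alpha> * (norm (m - y))\<^sup>2) * 2" using \<epsilon>(1) \<alpha>(1) by simp
    ultimately have "(\<epsilon> * \<alpha> * exp (- \<alpha> * (norm (m - y))\<^sup>2) * 2) * (\<nu> m \<bullet> (m - y)) < 0"
      by (rule mult_pos_neg[rotated])
    then show "\<nu> m \<bullet> ((\<epsilon> * \<alpha> * exp (- \<alpha> * (norm (m - y))\<^sup>2)) *\<^sub>R (2 *\<^sub>R (m - y))) < 0"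
      by (simp add: mult.assoc)
  qed
  also have "\<dots> = k * (- \<alpha> * (4 * ell \<sigma> (outer (m - y))) + 2 * T + 2 * K * norm (m - y))"
  proof -
    have o: "outer (2 *\<^sub>R (m - y)) = 4 *\<^sub>R outer (m - y)" by (simp add: outer_def vec_eq_iff algebra_simps)
    show ?thesis
      using \<epsilon>(1) \<alpha>(1) unfolding o ell_add ell_scale T_def[symmetric] norm_scaleR k_def h_def
      by (simp add: abs_mult algebra_simps power2_eq_square)
  qed
  also have "\<dots> < k * 0"
  proof (rule mult_strict_left_mono[OF _ k])
    have "R \<le> dist y m + dist x0 m" unfolding R_def by (rule dist_triangle2)
    moreover have "dist y m \<le> R + dist x0 m" unfolding R_def by (rule dist_triangle)
    ultimately have n: "R / 2 \<le> norm (m - y)" "norm (m - y) \<le> 3 * R / 2"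
      using m(2) \<rho>(2) by (auto simp: dist_norm norm_minus_commute)
    have "(R / 2)\<^sup>2 \<le> (norm (m - y))\<^sup>2" using n(1) R by (intro power_mono) auto
    then have "R\<^sup>2 \<le> 4 * (norm (m - y))\<^sup>2" by (simp add: power_divide)
    then have "c * R\<^sup>2 \<le> c * (4 * (norm (m - y))\<^sup>2)" using c(1) by (intro mult_left_mono) auto
    also have "\<dots> \<le> 4 * ell \<sigma> (outer (m - y))" using c(2)[of "m - y"] by simp
    finally have "\<alpha> * (c * R\<^sup>2) \<le> \<alpha> * (4 * ell \<sigma> (outer (m - y)))" using \<alpha>(1) by (intro mult_left_mono) auto
    moreover have "2 * K * norm (m - y) \<le> 2 * K * (3 * R / 2)" using n(2) K by (intro mult_left_mono) auto
    ultimately show "- \<alpha> * (4 * ell \<sigma> (outer (m - y))) + 2 * T + 2 * K * norm (m - y) < 0"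
      using \<alpha>(2) by simp
  qed
  finally show False using lam by simp
qed

text \<open>
  If the maximum set \<open>E\<close> misses a point \<open>y0\<close> of \<open>G\<close>, the barrier is centred at the midpoint of \<open>y0\<close> and
  a nearest point \<open>x0\<close> of \<open>E\<close>; halving the radius makes \<open>x0\<close> the only contact point. When
  \<open>x0\<close> is on the frontier, convexity supplies the strict inward direction.
\<close>

lemma strong_maximum_principle:
  assumes lam: "lam2 \<le> lam1" and a: "a \<in> closure G" and x: "x \<in> closure G"
  shows "v1 x - v2 x = v1 a - v2 a"
proof -
  define w where "w x = v1 x - v2 x" for x
  have w_cont: "continuous_on (closure G) w"
    unfolding w_def by (intro continuous_intros v1_cont v2_cont)
  obtain m where m: "m \<in> closure G" "\<And>x. x \<in> closure G \<Longrightarrow> w x \<le> w m"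
  proof -
    have "closure G \<noteq> {}" using a by (metis empty_iff)
    from continuous_attains_sup[OF compact_closure_G this w_cont] that show ?thesis by blast
  qed
  define E where "E = {x \<in> closure G. w x = w m}"
  have E: "closed E"
    unfolding E_def by (rule continuous_closed_preimage_constant[OF w_cont closed_closure])
  have "G \<subseteq> E"
  proof (rule ccontr)
    assume "\<not> G \<subseteq> E"
    then obtain y0 where y0: "y0 \<in> G" "y0 \<notin> E" by blast
    obtain x0 where x0: "x0 \<in> E" "\<And>x. x \<in> E \<Longrightarrow> dist y0 x0 \<le> dist y0 x"
    proof -
      have "E \<noteq> {}" using m(1) by (auto simp: E_def)
      from distance_attains_inf[OF E this, of y0] that show ?thesis by blast
    qed
    define y where "y = (1/2) *\<^sub>R (y0 + x0)"
    have yx0: "y - x0 = (1/2) *\<^sub>R (y0 - x0)" by (simp add: y_def vec_eq_iff field_simps)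
    have "y0 \<noteq> x0" using x0(1) y0(2) by blast
    show False
    proof (rule hopf_barrier[of x0 "w m" y])
      show "x0 \<in> closure G" "v1 x0 - v2 x0 = w m" using x0(1) by (auto simp: E_def w_def)
      show "y \<noteq> x0" using yx0 \<open>y0 \<noteq> x0\<close> by auto
      show "z = x0" if z: "z \<in> closure G" "dist y z \<le> dist y x0" "v1 z - v2 z = w m" for z
      proof -
        have "dist y0 x0 \<le> dist y0 z" using z by (intro x0(2)) (auto simp: E_def w_def)
        then have "(norm (y0 - x0))\<^sup>2 \<le> (norm (y0 - z))\<^sup>2" by (intro power_mono) (auto simp: dist_norm)
        moreover have "(norm (y - z))\<^sup>2 \<le> (norm (y - x0))\<^sup>2" using z(2) by (intro power_mono) (auto simp: dist_norm)
        moreover have "(norm (y0 - z))\<^sup>2 + (norm (z - x0))\<^sup>2 = 2 * (norm (y - z))\<^sup>2 + (norm (y0 - x0))\<^sup>2 / 2"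
          unfolding power2_norm_eq_inner y_def
          by (simp add: inner_diff_left inner_diff_right inner_add_left inner_add_right inner_commute)
            (simp add: field_simps)
        moreover have "(norm (y - x0))\<^sup>2 = (norm (y0 - x0))\<^sup>2 / 4"
          unfolding yx0 by (simp add: power_divide)
        ultimately have "(norm (z - x0))\<^sup>2 \<le> 0" by linarith
        then show ?thesis by simp
      qed
      show "0 < \<nu> x0 \<bullet> (y - x0)" if "x0 \<in> frontier G"
        using inward_normal_strict[OF that y0(1)] by (simp add: yx0)
    qed (use m(2) lam in \<open>auto simp: w_def\<close>)
  qed
  then have "closure G \<subseteq> E" using E by (rule closure_minimal)
  then have "x \<in> E" "a \<in> E" using a x by blast+
  then have "w x = w a" by (simp add: E_def)
  then show ?thesis by (simp only: w_def)
qed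

lemma ergodic_constant_le:
  assumes a: "a \<in> closure G"
  shows "lam1 \<le> lam2"
proof (rule ccontr)
  assume "\<not> lam1 \<le> lam2"
  then have lam: "lam2 < lam1" by simp
  from a have "G \<noteq> {}" by auto
  then obtain x0 where x0: "x0 \<in> G" by blast
  then have x0c: "x0 \<in> closure G" using closure_subset by blast
  have "v1 x - v2 x - (0 \<bullet> x + 0) \<le> v1 x0 - v2 x0 - (0 \<bullet> x0 + 0)" if "x \<in> closure G" for x
    unfolding strong_maximum_principle[OF less_imp_le[OF lam] x0c that] by simp
  then have "touches_above (closure G) (\<lambda>x. 0 \<bullet> x + 0) (\<lambda>x. v1 x - v2 x) x0"
    unfolding touches_above_def by (intro conjI x0c exI[of _ 1] ballI zero_less_one) (elim IntE)
  then have "lam1 - lam2 \<le> ell \<sigma> 0 + K * norm (0 :: real^'d)"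
    by (rule difference_subsolution[OF C2_with_affine]) (use frontier_not_in x0 in blast)
  with lam show False by simp
qed

end

section \<open>Uniqueness for the ergodic problem\<close>

context convex_domain
begin

lemma grad_\<phi>: "grad \<phi> x = \<nu> x"
  by (rule grad_eqI[OF \<phi>])

lemma interior_op_eq:
  "C2_with \<Psi> D H \<Longrightarrow>
   interior_op b \<sigma> f lam \<Psi> x = ell \<sigma> (H x) + (b x \<bullet> D x + f x (D x v* \<sigma>)) - lam"
  by (simp add: interior_op_def generator_def ell_def C2_with_grad C2_with_hessian)

lemma viscosity_subsolution_neumann:
  assumes "viscosity_subsolution G \<phi> b \<sigma> f g v lam"
  shows "neumann_subsolution \<sigma> (\<lambda>x p. b x \<bullet> p + f x (p v* \<sigma>)) g v lam"
  unfolding neumann_subsolution_def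
proof (intro allI impI)
  fix \<Psi> D H x
  assume \<Psi>: "C2_with \<Psi> D H" and t: "touches_above (closure G) \<Psi> v x"
  have x: "x \<in> closure G" using t by (simp add: touches_above_def)
  have "class_C 2 UNIV \<Psi> \<and> local_max_on (closure G) (\<lambda>y. v y - \<Psi> y) x"
    using C2_with_class_C[OF \<Psi>] t by (simp add: local_max_on_def touches_above_def)
  then have *: "x \<in> G \<Longrightarrow> 0 \<le> interior_op b \<sigma> f lam \<Psi> x"
    "x \<in> frontier G \<Longrightarrow> 0 \<le> max (interior_op b \<sigma> f lam \<Psi> x) (boundary_op \<phi> g \<Psi> x)"
    using assms unfolding viscosity_subsolution_def by blast+
  show "x \<in> frontier G \<and> 0 \<le> \<nu> x \<bullet> D x + g x \<or>
      lam \<le> ell \<sigma> (H x) + (b x \<bullet> D x + f x (D x v* \<sigma>))"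
    using closure_cases[OF x] *
    unfolding interior_op_eq[OF \<Psi>] boundary_op_def grad_\<phi> C2_with_grad[OF \<Psi>] le_max_iff_disj
    by auto
qed

lemma viscosity_supersolution_neumann:
  assumes "viscosity_supersolution G \<phi> b \<sigma> f g v lam"
  shows "neumann_subsolution \<sigma> (\<lambda>x p. - (b x \<bullet> (- p) + f x ((- p) v* \<sigma>))) (\<lambda>x. - g x) (\<lambda>x. - v x) (- lam)"
  unfolding neumann_subsolution_def
proof (intro allI impI)
  fix \<Psi> D H x
  assume \<Psi>: "C2_with \<Psi> D H" and t: "touches_above (closure G) \<Psi> (\<lambda>x. - v x) x"
  have x: "x \<in> closure G" using t by (simp add: touches_above_def)
  have C: "C2_with (\<lambda>y. - 1 * \<Psi> y) (\<lambda>y. - 1 *\<^sub>R D y) (\<lambda>y. - 1 *\<^sub>R H y)"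
    by (rule C2_with_scale[OF \<Psi>])
  have "local_min_on (closure G) (\<lambda>y. v y - - 1 * \<Psi> y) x"
    using t unfolding local_min_on_def touches_above_def by force
  then have *: "x \<in> G \<Longrightarrow> interior_op b \<sigma> f lam (\<lambda>y. - 1 * \<Psi> y) x \<le> 0"
    "x \<in> frontier G \<Longrightarrow>
       min (interior_op b \<sigma> f lam (\<lambda>y. - 1 * \<Psi> y) x) (boundary_op \<phi> g (\<lambda>y. - 1 * \<Psi> y) x) \<le> 0"
    using assms C2_with_class_C[OF C] unfolding viscosity_supersolution_def by blast+
  show "x \<in> frontier G \<and> 0 \<le> \<nu> x \<bullet> D x + - g x \<or>
      - lam \<le> ell \<sigma> (H x) + - (b x \<bullet> (- D x) + f x ((- D x) v* \<sigma>))"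
    using closure_cases[OF x] *
    unfolding interior_op_eq[OF C] boundary_op_def grad_\<phi> C2_with_grad[OF C] min_le_iff_disj ell_scale
    by auto
qed

end

text \<open>
  Both moduli of \<open>f\<close> are transported through \<open>z = p \<sigma>\<close>; for the drift,
  \<open>|b x - b y| |p| \<le> L (1 + |p|) |x - y|\<close>.
\<close>

lemma first_order_term_regularity:
  fixes b :: "real^'d \<Rightarrow> real^'d" and f :: "real^'d \<Rightarrow> real^'d \<Rightarrow> real" and \<sigma> :: "real^'d^'d"
  assumes S: "bounded S" and b: "L-lipschitz_on S b"
    and C: "C > 0" and f_lip: "\<And>x z z'. x \<in> S \<Longrightarrow> \<bar>f x z - f x z'\<bar> \<le> C * norm (z - z')"
    and m: "(m \<longlongrightarrow> 0) (at_right 0)"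
    and f_mod: "\<And>x y z. x \<in> S \<Longrightarrow> y \<in> S \<Longrightarrow> x \<noteq> y \<Longrightarrow>
        \<bar>f x z - f y z\<bar> \<le> m ((1 + norm z) * norm (x - y))"
  defines "F \<equiv> \<lambda>x p. b x \<bullet> p + f x (p v* \<sigma>)"
  obtains K where "0 \<le> K" "\<And>x p q. x \<in> S \<Longrightarrow> \<bar>F x p - F x q\<bar> \<le> K * norm (p - q)"
    "\<And>\<kappa>. \<kappa> > 0 \<Longrightarrow> \<exists>\<delta>>0. \<forall>x\<in>S. \<forall>y\<in>S. \<forall>p.
        (1 + norm p) * norm (x - y) < \<delta> \<longrightarrow> \<bar>F x p - F y p\<bar> \<le> \<kappa>"
proof -
  obtain N where N: "N > 0" "\<And>p. norm (transpose \<sigma> *v p) \<le> N * norm p"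
    using linear_bounded_pos[OF matrix_vector_mul_linear[of "transpose \<sigma>"]] by auto
  have vm: "p v* \<sigma> = transpose \<sigma> *v p" for p by simp
  have "bounded (b ` S)" 
    by (rule bounded_uniformly_continuous_image[OF lipschitz_on_uniformly_continuous[OF b] S])
  then obtain B where B: "B > 0" "\<And>x. x \<in> S \<Longrightarrow> norm (b x) \<le> B"
    unfolding bounded_pos by auto
  have L: "0 \<le> L" using b by (rule lipschitz_on_nonneg)
  show ?thesis
  proof (rule that[of "B + C * N"])
    show "0 \<le> B + C * N" using B C N by simp
    fix x p q assume x: "x \<in> S"
    have "\<bar>b x \<bullet> (p - q)\<bar> \<le> norm (b x) * norm (p - q)" by (rule Cauchy_Schwarz_ineq2)
    also have "\<dots> \<le> B * norm (p - q)" using B(2)[OF x] by (intro mult_right_mono) auto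
    finally have 1: "\<bar>b x \<bullet> p - b x \<bullet> q\<bar> \<le> B * norm (p - q)" by (simp add: inner_diff_right)
    have "\<bar>f x (p v* \<sigma>) - f x (q v* \<sigma>)\<bar> \<le> C * norm (transpose \<sigma> *v (p - q))"
      using f_lip[OF x, of "p v* \<sigma>" "q v* \<sigma>"] unfolding vm matrix_vector_mult_diff_distrib .
    also have "\<dots> \<le> C * (N * norm (p - q))" using C N by (intro mult_left_mono) auto
    finally show "\<bar>F x p - F x q\<bar> \<le> (B + C * N) * norm (p - q)"
      using 1 unfolding F_def distrib_right mult.assoc by linarith
  next
    fix \<kappa> :: real assume \<kappa>: "\<kappa> > 0"
    have "eventually (\<lambda>t. \<bar>m t\<bar> < \<kappa> / 2) (at_right 0)"
      using tendstoD[OF m, of "\<kappa>/2"] \<kappa> by (simp add: dist_real_def)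
    then obtain \<gamma> where \<gamma>: "\<gamma> > 0" "\<And>t. 0 < t \<Longrightarrow> t < \<gamma> \<Longrightarrow> \<bar>m t\<bar> < \<kappa> / 2"
      by (auto simp: eventually_at_right_field)
    define \<delta> where "\<delta> = min (\<gamma> / (1 + N)) (\<kappa> / (2 * (L + 1)))"
    have \<delta>: "\<delta> > 0" "(1 + N) * \<delta> \<le> \<gamma>" "(L + 1) * \<delta> \<le> \<kappa> / 2"
    proof -
      have "0 < 1 + N" "0 < L + 1" using N L by auto
      then have "(1 + N) * \<delta> \<le> (1 + N) * (\<gamma> / (1 + N))" "(L + 1) * \<delta> \<le> (L + 1) * (\<kappa> / (2 * (L + 1)))"
        by (auto simp only: \<delta>_def intro!: mult_left_mono)
      moreover have "(1 + N) * (\<gamma> / (1 + N)) = \<gamma>" "(L + 1) * (\<kappa> / (2 * (L + 1))) = \<kappa> / 2"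
        using \<open>0 < 1 + N\<close> \<open>0 < L + 1\<close> by (auto simp: field_simps)
      ultimately show "(1 + N) * \<delta> \<le> \<gamma>" "(L + 1) * \<delta> \<le> \<kappa> / 2" by linarith+
      show "\<delta> > 0" using \<open>0 < 1 + N\<close> \<open>0 < L + 1\<close> \<gamma>(1) \<kappa> by (simp add: \<delta>_def)
    qed
    have "\<bar>F x p - F y p\<bar> \<le> \<kappa>" if x: "x \<in> S" and y: "y \<in> S" and d: "(1 + norm p) * norm (x - y) < \<delta>"
      for x y p
    proof (cases "x = y")
      case False
      define t where "t = (1 + norm (p v* \<sigma>)) * norm (x - y)"
      have "0 < t" unfolding t_def using False by (intro mult_pos_pos add_pos_nonneg) auto
      have "norm (p v* \<sigma>) \<le> N * norm p" unfolding vm by (rule N(2))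
      then have "1 + norm (p v* \<sigma>) \<le> (1 + N) * (1 + norm p)"
      proof -
        have "(1 + N) * (1 + norm p) = 1 + N + norm p + N * norm p" by (simp add: algebra_simps)
        then show ?thesis using N(1) norm_ge_zero[of p] \<open>norm (p v* \<sigma>) \<le> N * norm p\<close> by linarith
      qed
      then have "t \<le> (1 + N) * (1 + norm p) * norm (x - y)"
        unfolding t_def by (rule mult_right_mono) simp
      also have "\<dots> < (1 + N) * \<delta>"
        unfolding mult.assoc using d N(1) by (intro mult_strict_left_mono) auto
      finally have "t < \<gamma>" using \<delta>(2) by linarith
      then have 1: "\<bar>f x (p v* \<sigma>) - f y (p v* \<sigma>)\<bar> < \<kappa> / 2"
        using f_mod[OF x y False, of "p v* \<sigma>"] \<gamma>(2)[OF \<open>0 < t\<close>] unfolding t_def by linarith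
      have "\<bar>(b x - b y) \<bullet> p\<bar> \<le> norm (b x - b y) * norm p" by (rule Cauchy_Schwarz_ineq2)
      also have "\<dots> \<le> L * norm (x - y) * norm p"
        using lipschitz_onD[OF b x y] by (intro mult_right_mono) (auto simp: dist_norm)
      also have "\<dots> \<le> (L + 1) * ((1 + norm p) * norm (x - y))"
        using L by (simp add: algebra_simps add_increasing2)
      also have "\<dots> \<le> (L + 1) * \<delta>" using d L by (intro mult_left_mono) auto
      finally have "\<bar>b x \<bullet> p - b y \<bullet> p\<bar> \<le> \<kappa> / 2" using \<delta>(3) by (simp add: inner_diff_left)
      then show ?thesis using 1 unfolding F_def by linarith
    qed (use \<kappa> in auto)
    with \<delta>(1) show "\<exists>\<delta>>0. \<forall>x\<in>S. \<forall>y\<in>S. \<forall>p. (1 + norm p) * norm (x - y) < \<delta> \<longrightarrow> \<bar>F x p - F y p\<bar> \<le> \<kappa>"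
      by blast
  qed
qed

lemma class_C_lip_Suc_continuous:
  assumes "class_C_lip (Suc k) S u"
  shows "continuous_on S u"
proof -
  obtain D where "\<And>x. x \<in> S \<Longrightarrow> (u has_derivative (\<lambda>h. D x \<bullet> h)) (at x within S)"
    using assms by auto
  then have "u differentiable_on S"
    unfolding differentiable_on_def differentiable_def by blast
  then show ?thesis by (rule differentiable_imp_continuous_on)
qed

theorem lemma3p18:
  fixes G :: "(real^'d) set"
    and \<phi> g v1 v2 :: "real^'d \<Rightarrow> real"
    and b :: "real^'d \<Rightarrow> real^'d"
    and \<sigma> :: "real^'d^'d"
    and f :: "real^'d \<Rightarrow> real^'d \<Rightarrow> real"
    and lam1 lam2 :: real
    and a :: "real^'d"
  assumes "\<exists>L. L-lipschitz_on (closure G) b"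
    and "invertible \<sigma>"
    and "bounded G" and "convex G" and "open G"
    and "boundary_sobolev_inf 3 G"
    and "class_C_lip 2 UNIV \<phi>"
    and "G = {x. \<phi> x > 0}"
    and "frontier G = {x. \<phi> x = 0}"
    and "\<forall>x\<in>frontier G. norm (grad \<phi> x) = 1"
    and "\<forall>z. continuous_on (closure G) (\<lambda>x. f x z)"
    and "\<exists>C>0. \<forall>x\<in>closure G. \<forall>z z'. \<bar>f x z - f x z'\<bar> \<le> C * norm (z - z')"
    and "\<exists>m :: real \<Rightarrow> real. continuous_on {0<..} m \<and> (m \<longlongrightarrow> 0) (at_right 0) \<and>
           (\<forall>x\<in>closure G. \<forall>y\<in>closure G. x \<noteq> y \<longrightarrow>
              (\<forall>z. \<bar>f x z - f y z\<bar> \<le> m ((1 + norm z) * norm (x - y))))"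
    and "class_C_lip 1 (closure G) g"
    and "viscosity_solution G \<phi> b \<sigma> f g v1 lam1"
    and "viscosity_solution G \<phi> b \<sigma> f g v2 lam2"
    and "a \<in> closure G" and "v1 a = v2 a"
  shows "lam1 = lam2 \<and> (\<forall>x\<in>closure G. v1 x = v2 x)"
proof -
  obtain \<nu> where \<nu>: "\<And>x. (\<phi> has_derivative (\<lambda>h. \<nu> x \<bullet> h)) (at x)"
    and \<nu>i: "\<And>i. class_C_lip (Suc 0) UNIV (\<lambda>x. \<nu> x $ i)"
    using assms(7) unfolding numeral_2_eq_2 class_C_lip.simps(2)[of "Suc 0"] by auto
  have "continuous_on UNIV (\<lambda>x. \<chi> i. \<nu> x $ i)"
    using class_C_lip_Suc_continuous[OF \<nu>i] by (intro continuous_on_vec_lambda)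
  then have \<nu>_cont: "continuous_on UNIV \<nu>" by simp
  have grad: "grad \<phi> x = \<nu> x" for x by (rule grad_eqI[OF \<nu>])
  interpret convex_domain G \<phi> \<nu>
    by unfold_locales (use assms(3-5,8-10) \<nu> \<nu>_cont grad in auto)
  obtain \<tau> where \<tau>: "\<tau> ** \<sigma> = mat 1" using assms(2) unfolding invertible_def by blast
  obtain L where L: "L-lipschitz_on (closure G) b" using assms(1) by blast
  obtain C where C: "C > 0" "\<And>x z z'. x \<in> closure G \<Longrightarrow> \<bar>f x z - f x z'\<bar> \<le> C * norm (z - z')"
    using assms(12) by blast
  obtain m :: "real \<Rightarrow> real" where m: "(m \<longlongrightarrow> 0) (at_right 0)"
    "\<And>x y z. x \<in> closure G \<Longrightarrow> y \<in> closure G \<Longrightarrow> x \<noteq> y \<Longrightarrow>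
        \<bar>f x z - f y z\<bar> \<le> m ((1 + norm z) * norm (x - y))"
    using assms(13) by blast
  define F where "F = (\<lambda>x p. b x \<bullet> p + f x (p v* \<sigma>))"
  obtain K where K: "0 \<le> K" and F_lip: "\<And>x p q. x \<in> closure G \<Longrightarrow> \<bar>F x p - F x q\<bar> \<le> K * norm (p - q)"
    and F_mod: "\<And>\<kappa>. \<kappa> > 0 \<Longrightarrow> \<exists>\<delta>>0. \<forall>x\<in>closure G. \<forall>y\<in>closure G. \<forall>p.
        (1 + norm p) * norm (x - y) < \<delta> \<longrightarrow> \<bar>F x p - F y p\<bar> \<le> \<kappa>"
    unfolding F_def
    using first_order_term_regularity[OF bounded_closure[OF assms(3)] L C m, of \<sigma>] by blast
  have g: "continuous_on (closure G) g"
    using assms(14) unfolding One_nat_def by (rule class_C_lip_Suc_continuous)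
  have pair: "neumann_pair G \<phi> \<nu> \<sigma> \<tau> F K g v w lam mu"
    if v: "viscosity_solution G \<phi> b \<sigma> f g v lam" and w: "viscosity_solution G \<phi> b \<sigma> f g w mu" for v w lam mu
  proof unfold_locales
    show "neumann_subsolution \<sigma> F g v lam"
      unfolding F_def using v by (intro viscosity_subsolution_neumann) (simp add: viscosity_solution_def)
    show "neumann_subsolution \<sigma> (\<lambda>x p. - F x (- p)) (\<lambda>x. - g x) (\<lambda>x. - w x) (- mu)"
      unfolding F_def using w by (intro viscosity_supersolution_neumann) (simp add: viscosity_solution_def)
  qed (use \<tau> K F_lip F_mod g v w in \<open>auto simp: viscosity_solution_def\<close>)
  have "lam1 \<le> lam2" "lam2 \<le> lam1"
    by (rule neumann_pair.ergodic_constant_le[OF pair[OF assms(15,16)] assms(17)],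
        rule neumann_pair.ergodic_constant_le[OF pair[OF assms(16,15)] assms(17)])
  moreover have "v1 x = v2 x" if "x \<in> closure G" for x
    using neumann_pair.strong_maximum_principle[OF pair[OF assms(15,16)] \<open>lam2 \<le> lam1\<close> assms(17) that] assms(18)
    by simp
  ultimately show ?thesis by simp
qed

end
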